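(* Let $q\in(0,\tfrac12]$ be a constant, let $k=k_N$ with $k\to\infty$ and $k=o(N)$, and let $\nu=\nu_k>0$ satisfy $(1-\nu_k/k)^k=q$. Consider the non-adaptive Bernoulli group testing model: $\theta$ is uniform on $\Theta=\{\theta\in\{0,1/\sqrt k\}^N:\|\theta\|_0=k\}$; independently, $X_1,\dots,X_n$ are i.i.d. with law $\mathrm{Bernoulli}(\nu/k)^{\otimes N}$ on $\{0,1\}^N$; and one observes $(Y_i,X_i)$, $i=1,\dots,n$, where $Y_i=\mathbf 1(\langle X_i,\theta\rangle\geq 1/\sqrt k)$. Then this model exhibits the all-or-nothing phenomenon at number of tests $$n^*=\left\lfloor\frac{\log\binom{N}{k}}{h(q)}\right\rfloor=(1+o(1))\frac{k\log\frac Nk}{h(q)}.$$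
   Context: $\|\theta\|_0$ is the number of nonzero coordinates of $\theta$. $h(t)=-t\log t-(1-t)\log(1-t)$ is the binary entropy (natural logarithm). $\mathrm{MMSE}_N(n)=\mathbb E\|\theta-\mathbb E[\theta\mid Y^n,X^n]\|^2$, where $Y^n=(Y_i)_{i\le n}$, $X^n=(X_i)_{i\le n}$. The model exhibits the all-or-nothing phenomenon at critical sample sizes $n_c$ if $\lim_{N\to\infty}\mathrm{MMSE}_N(\lfloor\beta n_c\rfloor)=1$ for every fixed $\beta<1$ and $\lim_{N\to\infty}\mathrm{MMSE}_N(\lfloor\beta n_c\rfloor)=0$ for every fixed $\beta>1$. *)

theory Defs
  imports "HOL-Analysis.Analysis"
begin

definition bin_entropy :: "real \<Rightarrow> real" where
  "bin_entropy t = - t * ln t - (1 - t) * ln (1 - t)"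

definition Theta :: "nat \<Rightarrow> nat \<Rightarrow> (nat \<Rightarrow> real) set" where
  "Theta N k = {\<theta>. (\<forall>j<N. \<theta> j \<in> {0, 1 / sqrt (real k)}) \<and> (\<forall>j\<ge>N. \<theta> j = 0)
                    \<and> card {j. j < N \<and> \<theta> j \<noteq> 0} = k}"

definition Designs :: "nat \<Rightarrow> nat \<Rightarrow> (nat \<Rightarrow> nat \<Rightarrow> real) set" where
  "Designs n N = {X. (\<forall>i j. X i j \<in> {0, 1}) \<and> (\<forall>i j. \<not> (i < n \<and> j < N) \<longrightarrow> X i j = 0)}"

definition design_prob :: "nat \<Rightarrow> nat \<Rightarrow> real \<Rightarrow> (nat \<Rightarrow> nat \<Rightarrow> real) \<Rightarrow> real" where
  "design_prob n N p X = (\<Prod>i<n. \<Prod>j<N. if X i j = 1 then p else 1 - p)"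

definition obs :: "nat \<Rightarrow> nat \<Rightarrow> nat \<Rightarrow> (nat \<Rightarrow> real) \<Rightarrow> (nat \<Rightarrow> nat \<Rightarrow> real) \<Rightarrow> nat \<Rightarrow> real" where
  "obs N k n \<theta> X = (\<lambda>i. if i < n \<and> (\<Sum>j<N. X i j * \<theta> j) \<ge> 1 / sqrt (real k) then 1 else 0)"

text \<open>Posterior mean E[theta | Y = y, X]: theta uniform on Theta and Y a deterministic
  function of (theta, X), X independent of theta, so the posterior is uniform on the
  parameters consistent with the observation.\<close>
definition post_mean :: "nat \<Rightarrow> nat \<Rightarrow> nat \<Rightarrow> (nat \<Rightarrow> nat \<Rightarrow> real) \<Rightarrow> (nat \<Rightarrow> real) \<Rightarrow> nat \<Rightarrow> real" where
  "post_mean N k n X y = (\<lambda>j.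
     (\<Sum>\<theta>'\<in>{\<theta>'\<in>Theta N k. obs N k n \<theta>' X = y}. \<theta>' j)
       / real (card {\<theta>'\<in>Theta N k. obs N k n \<theta>' X = y}))"

definition MMSE :: "nat \<Rightarrow> nat \<Rightarrow> real \<Rightarrow> nat \<Rightarrow> real" where
  "MMSE N k \<nu> n =
     (\<Sum>\<theta>\<in>Theta N k. \<Sum>X\<in>Designs n N.
        (1 / real (card (Theta N k))) * design_prob n N (\<nu> / real k) X *
        (\<Sum>j<N. (\<theta> j - post_mean N k n X (obs N k n \<theta> X) j)^2))"

definition nstar :: "nat \<Rightarrow> nat \<Rightarrow> real \<Rightarrow> nat" where
  "nstar N k q = nat \<lfloor>ln (real (N choose k)) / bin_entropy q\<rfloor>"

end

theory Submission
  imports Defs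
begin

text \<open>
  The signal is a support \<open>S\<close> of size \<open>k\<close>, the outcome is the set \<open>B\<close> of negative tests, and
  the posterior is uniform on the supports consistent with \<open>B\<close>. Since signals have norm 1, the MMSE is
  1 minus the expected overlap \<open>card (S \<inter> S') / k\<close> of the truth with an independent posterior sample.

  Each test is negative with probability \<open>q\<close>, so a typical outcome (about \<open>q * n\<close> negatives) has
  probability about \<open>exp (- n * h)\<close> with \<open>h = bin_entropy q\<close>. For supports of overlap \<open>t\<close>, both tests
  are negative with probability \<open>q powr (2 - t)\<close> and, because \<open>q \<le> 1 / 2\<close>, both are positive with
  probability at most \<open>(1 - q) powr (2 - t)\<close>. Hence they share a typical outcome with probability at
  most about \<open>exp (- (1 - t) * n * h)\<close>, while there are about \<open>exp ((1 - t) * L)\<close> supports of overlap \<open>t\<close>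
  with \<open>S\<close>, where \<open>L = ln (N choose k)\<close>. The expected number of consistent supports of overlap \<open>t\<close> is
  thus about \<open>exp ((1 - t) * (L - n * h))\<close>.

  If \<open>n * h > L\<close>, no support of overlap below \<open>1 - \<epsilon>\<close> survives. If \<open>n * h < L\<close>, at most \<open>exp (n * h)\<close>
  typical outcomes share all \<open>exp L\<close> supports, so the consistent class has size about
  \<open>exp (L - n * h)\<close> with high probability, and the supports of overlap above \<open>\<epsilon>\<close> are a
  negligible fraction of it.
\<close>

section \<open>Supports, pools and outcomes as finite sets\<close>

definition supports :: "nat \<Rightarrow> nat \<Rightarrow> nat set set" where
  "supports N k = {S. S \<subseteq> {..<N} \<and> card S = k}"

definition pool :: "nat \<Rightarrow> (nat \<Rightarrow> nat \<Rightarrow> real) \<Rightarrow> nat \<Rightarrow> nat set" where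
  "pool N X i = {j. j < N \<and> X i j = 1}"

text \<open>A test is positive exactly when its pool meets the support, so this set carries the same
  information as the outcome vector \<open>Y\<close>.\<close>

definition negatives :: "nat \<Rightarrow> nat \<Rightarrow> (nat \<Rightarrow> nat \<Rightarrow> real) \<Rightarrow> nat set \<Rightarrow> nat set" where
  "negatives N n X S = {i. i < n \<and> pool N X i \<inter> S = {}}"

definition consistent :: "nat \<Rightarrow> nat \<Rightarrow> nat \<Rightarrow> (nat \<Rightarrow> nat \<Rightarrow> real) \<Rightarrow> nat set \<Rightarrow> nat set set" where
  "consistent N k n X B = {S \<in> supports N k. negatives N n X S = B}"

definition signal :: "nat \<Rightarrow> nat set \<Rightarrow> nat \<Rightarrow> real" where
  "signal k S j = (if j \<in> S then 1 / sqrt (real k) else 0)"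

text \<open>For \<open>S\<close> in \<open>supports N k\<close> this is the inner product of
  \<open>signal k S\<close> with the posterior mean given the outcome that \<open>S\<close>
  produces. Equivalently, it is the expected normalised overlap of \<open>S\<close> with a uniform
  draw from its consistent class.\<close>

definition mean_overlap :: "nat \<Rightarrow> nat \<Rightarrow> nat \<Rightarrow> (nat \<Rightarrow> nat \<Rightarrow> real) \<Rightarrow> nat set \<Rightarrow> real" where
  "mean_overlap N k n X S =
     (\<Sum>S'\<in>consistent N k n X (negatives N n X S). real (card (S \<inter> S')) / real k)
       / real (card (consistent N k n X (negatives N n X S)))"

lemma finite_supports [simp]: "finite (supports N k)"
  by (rule finite_subset[of _ "Pow {..<N}"]) (auto simp: supports_def)

lemma card_supports: "card (supports N k) = N choose k"
  using n_subsets[of "{..<N}" k] by (simp add: supports_def)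

lemma finite_consistent [simp]: "finite (consistent N k n X B)"
  by (simp add: consistent_def)

subsection \<open>The Bernoulli design\<close>

text \<open>A design is the same thing as an \<open>n\<close>-tuple of pools, so a sum over designs
  of a product over tests factorises. This is the independence of the tests.\<close>

lemma sum_Designs_pools:
  fixes G :: "nat \<Rightarrow> nat set \<Rightarrow> real"
  shows "(\<Sum>X\<in>Designs n N. \<Prod>i<n. G i (pool N X i)) = (\<Prod>i<n. \<Sum>A\<in>Pow {..<N}. G i A)"
proof -
  let ?D = "PiE {..<n} (\<lambda>_. Pow {..<N})"
  let ?f = "\<lambda>X. \<lambda>i\<in>{..<n}. pool N X i"
  let ?g = "\<lambda>R i j. if i < n \<and> j < N \<and> j \<in> R i then 1 else 0 :: real"
  have "(\<Prod>i<n. \<Sum>A\<in>Pow {..<N}. G i A) = (\<Sum>R\<in>?D. \<Prod>i<n. G i (R i))"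
    by (rule prod_sum_PiE) auto
  also have "\<dots> = (\<Sum>X\<in>Designs n N. \<Prod>i<n. G i (pool N X i))"
  proof (rule sum.reindex_bij_witness[where i = ?f and j = ?g])
    show "?f (?g R) = R" if "R \<in> ?D" for R
    proof
      fix i show "?f (?g R) i = R i"
        using that by (cases "i < n") (auto simp: pool_def PiE_iff extensional_def)
    qed
    show "?g (?f X) = X" if "X \<in> Designs n N" for X
    proof (intro ext)
      fix i j
      have "X i j \<in> {0, 1}" "\<not> (i < n \<and> j < N) \<Longrightarrow> X i j = 0"
        using that by (auto simp: Designs_def)
      then show "?g (?f X) i j = X i j"
        by (cases "i < n"; cases "j < N") (auto simp: pool_def)
    qed
    show "(\<Prod>i<n. G i (pool N (?g R) i)) = (\<Prod>i<n. G i (R i))" if "R \<in> ?D" for R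
    proof (rule prod.cong)
      fix i assume "i \<in> {..<n}"
      then have "pool N (?g R) i = R i" using that by (auto simp: pool_def PiE_iff)
      then show "G i (pool N (?g R) i) = G i (R i)" by simp
    qed simp
  qed (auto simp: Designs_def pool_def)
  finally show ?thesis by simp
qed

lemma finite_Designs [simp]: "finite (Designs n N)"
proof -
  let ?g = "\<lambda>R i j. if i < n \<and> j < N \<and> j \<in> R i then 1 else 0 :: real"
  have "Designs n N \<subseteq> ?g ` PiE {..<n} (\<lambda>_. Pow {..<N})"
  proof
    fix X assume X: "X \<in> Designs n N"
    have "X = ?g (\<lambda>i\<in>{..<n}. pool N X i)"
    proof (intro ext)
      fix i j
      have "X i j \<in> {0, 1}" "\<not> (i < n \<and> j < N) \<Longrightarrow> X i j = 0"
        using X by (auto simp: Designs_def)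
      then show "X i j = ?g (\<lambda>i\<in>{..<n}. pool N X i) i j"
        by (cases "i < n"; cases "j < N") (auto simp: pool_def)
    qed
    moreover have "(\<lambda>i\<in>{..<n}. pool N X i) \<in> PiE {..<n} (\<lambda>_. Pow {..<N})"
      by (auto simp: pool_def)
    ultimately show "X \<in> ?g ` PiE {..<n} (\<lambda>_. Pow {..<N})" by blast
  qed
  then show ?thesis
    by (rule finite_subset) (intro finite_imageI finite_PiE, auto)
qed

definition pool_prob :: "nat \<Rightarrow> real \<Rightarrow> nat set \<Rightarrow> real" where
  "pool_prob N p A = (\<Prod>j<N. if j \<in> A then p else 1 - p)"

lemma design_prob_pools: "design_prob n N p X = (\<Prod>i<n. pool_prob N p (pool N X i))"
  unfolding design_prob_def pool_prob_def
  by (intro prod.cong refl) (auto simp: pool_def)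

text \<open>The indicator is absorbed into the product by replacing \<open>p\<close> with 0 on
  \<open>T\<close>. The sum over all subsets is then the expansion of a product over the items,
  whose factor is \<open>1 - p\<close> on \<open>T\<close> and 1 elsewhere.\<close>

lemma sum_pool_prob_disjoint:
  assumes "T \<subseteq> {..<N}"
  shows "(\<Sum>A\<in>Pow {..<N}. pool_prob N p A * of_bool (A \<inter> T = {})) = (1 - p) ^ card T"
proof -
  have split: "(\<Prod>j<N. if j \<in> A then u j else v j) = (\<Prod>j\<in>A. u j) * (\<Prod>j\<in>{..<N} - A. v j)"
    if "A \<in> Pow {..<N}" for A and u v :: "nat \<Rightarrow> real"
  proof -
    have "(\<Prod>j<N. if j \<in> A then u j else v j)
        = (\<Prod>j\<in>{..<N} \<inter> {j. j \<in> A}. u j) * (\<Prod>j\<in>{..<N} \<inter> - {j. j \<in> A}. v j)"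
      by (rule prod.If_cases) simp
    moreover have "{..<N} \<inter> {j. j \<in> A} = A" "{..<N} \<inter> - {j. j \<in> A} = {..<N} - A"
      using that by auto
    ultimately show ?thesis by simp
  qed
  have "(\<Sum>A\<in>Pow {..<N}. pool_prob N p A * of_bool (A \<inter> T = {}))
      = (\<Sum>A\<in>Pow {..<N}. \<Prod>j<N. if j \<in> A then (if j \<in> T then 0 else p) else 1 - p)"
  proof (rule sum.cong[OF refl])
    fix A assume A: "A \<in> Pow {..<N}"
    show "pool_prob N p A * of_bool (A \<inter> T = {})
        = (\<Prod>j<N. if j \<in> A then (if j \<in> T then 0 else p) else 1 - p)"
    proof (cases "A \<inter> T = {}")
      case True
      then show ?thesis
        unfolding pool_prob_def by (auto intro!: prod.cong)
    next
      case False
      then obtain j where "j \<in> A" "j \<in> T" by auto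
      then have "(\<Prod>j<N. if j \<in> A then (if j \<in> T then 0 else p) else 1 - p) = 0"
        using A by (intro prod_zero) auto
      with False show ?thesis by simp
    qed
  qed
  also have "\<dots> = (\<Prod>j<N. (if j \<in> T then 0 else p) + (1 - p))"
    by (subst prod_add) (auto intro!: sum.cong simp: split)
  also have "\<dots> = (\<Prod>j<N. if j \<in> T then 1 - p else 1)"
    by (intro prod.cong) auto
  also have "\<dots> = (1 - p) ^ card ({..<N} \<inter> T)"
    by (simp add: prod.If_cases)
  also have "{..<N} \<inter> T = T" using assms by auto
  finally show ?thesis .
qed

lemma design_prob_nonneg: "0 \<le> p \<Longrightarrow> p \<le> 1 \<Longrightarrow> 0 \<le> design_prob n N p X"
  unfolding design_prob_def by (intro prod_nonneg) auto

lemma prod_if_mem_power: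
  assumes "B \<subseteq> {..<n}"
  shows "(\<Prod>i<n. if i \<in> B then a else b) = (a::real) ^ card B * b ^ (n - card B)"
proof -
  have "{..<n} \<inter> {i. i \<in> B} = B" "{..<n} \<inter> - {i. i \<in> B} = {..<n} - B"
    using assms by auto
  moreover have "card ({..<n} - B) = n - card B"
    using assms by (subst card_Diff_subset) (auto intro: finite_subset)
  ultimately show ?thesis by (simp add: prod.If_cases)
qed

text \<open>Tests are independent. One in \<open>B\<close> has to miss \<open>S \<union> S'\<close>,
  which has probability \<open>r\<close>; one outside \<open>B\<close> has to hit both supports, and
  inclusion-exclusion gives its probability.\<close>

lemma prob_negatives_pair:
  fixes p :: real
  assumes S: "S \<subseteq> {..<N}" and S': "S' \<subseteq> {..<N}" and B: "B \<subseteq> {..<n}"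
  defines "r \<equiv> (1 - p) ^ card (S \<union> S')"
  shows "(\<Sum>X\<in>Designs n N. design_prob n N p X *
            of_bool (negatives N n X S = B \<and> negatives N n X S' = B))
       = r ^ card B * (1 - (1 - p) ^ card S - (1 - p) ^ card S' + r) ^ (n - card B)"
proof -
  let ?s = "1 - (1 - p) ^ card S - (1 - p) ^ card S' + r"
  define G where "G i A = pool_prob N p A *
     (if i \<in> B then of_bool (A \<inter> (S \<union> S') = {})
      else of_bool (A \<inter> S \<noteq> {} \<and> A \<inter> S' \<noteq> {}))" for i A
  have "(\<Sum>X\<in>Designs n N. design_prob n N p X *
            of_bool (negatives N n X S = B \<and> negatives N n X S' = B))
      = (\<Sum>X\<in>Designs n N. \<Prod>i<n. G i (pool N X i))"
  proof (rule sum.cong[OF refl])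
    fix X
    have iff: "(negatives N n X S = B \<and> negatives N n X S' = B) \<longleftrightarrow>
        (\<forall>i<n. if i \<in> B then pool N X i \<inter> (S \<union> S') = {}
               else pool N X i \<inter> S \<noteq> {} \<and> pool N X i \<inter> S' \<noteq> {})" (is "?L \<longleftrightarrow> ?R")
    proof
      assume ?L
      then show ?R by (auto simp: negatives_def)
    next
      assume R: ?R
      have "i \<in> negatives N n X S \<longleftrightarrow> i \<in> B" "i \<in> negatives N n X S' \<longleftrightarrow> i \<in> B" for i
        using R[rule_format, of i] B by (cases "i \<in> B"; auto simp: negatives_def)+
      then show ?L by blast
    qed
    show "design_prob n N p X * of_bool (negatives N n X S = B \<and> negatives N n X S' = B)
        = (\<Prod>i<n. G i (pool N X i))"
    proof (cases "negatives N n X S = B \<and> negatives N n X S' = B")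
      case True
      have "G i (pool N X i) = pool_prob N p (pool N X i)" if "i < n" for i
        using iff True that by (auto simp: G_def)
      then have "(\<Prod>i<n. G i (pool N X i)) = (\<Prod>i<n. pool_prob N p (pool N X i))"
        by (intro prod.cong) auto
      then show ?thesis using True by (simp add: design_prob_pools)
    next
      case False
      then obtain i where i: "i < n" "\<not> (if i \<in> B then pool N X i \<inter> (S \<union> S') = {}
               else pool N X i \<inter> S \<noteq> {} \<and> pool N X i \<inter> S' \<noteq> {})"
        unfolding iff by blast
      then have "G i (pool N X i) = 0" by (cases "i \<in> B") (simp_all add: G_def)
      with i(1) have zero: "(\<Prod>i<n. G i (pool N X i)) = 0" by (intro prod_zero) auto
      show ?thesis unfolding zero using False by simp
    qed
  qed
  also have "\<dots> = (\<Prod>i<n. \<Sum>A\<in>Pow {..<N}. G i A)"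
    by (rule sum_Designs_pools)
  also have "\<dots> = (\<Prod>i<n. if i \<in> B then r else ?s)"
  proof (rule prod.cong[OF refl])
    fix i
    have U: "S \<union> S' \<subseteq> {..<N}" using S S' by simp
    \<comment> \<open>Inclusion-exclusion; the certain event is written as missing the empty set, so
      that all four terms are instances of \<open>sum_pool_prob_disjoint\<close>.\<close>
    have "(\<Sum>A\<in>Pow {..<N}. pool_prob N p A * of_bool (A \<inter> S \<noteq> {} \<and> A \<inter> S' \<noteq> {}))
       = (\<Sum>A\<in>Pow {..<N}. pool_prob N p A * of_bool (A \<inter> {} = {})
            - pool_prob N p A * of_bool (A \<inter> S = {}) - pool_prob N p A * of_bool (A \<inter> S' = {})
            + pool_prob N p A * of_bool (A \<inter> (S \<union> S') = {}))"
      by (intro sum.cong refl) (auto simp: Int_Un_distrib of_bool_def)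
    also have "\<dots> = ?s"
      unfolding sum.distrib sum_subtractf sum_pool_prob_disjoint[OF S] sum_pool_prob_disjoint[OF S']
        sum_pool_prob_disjoint[OF U] sum_pool_prob_disjoint[OF empty_subsetI]
      by (simp add: r_def)
    finally show "(\<Sum>A\<in>Pow {..<N}. G i A) = (if i \<in> B then r else ?s)"
      using sum_pool_prob_disjoint[OF U, of p] by (simp add: G_def r_def)
  qed
  also have "\<dots> = r ^ card B * ?s ^ (n - card B)"
    by (rule prod_if_mem_power[OF B])
  finally show ?thesis .
qed

lemma prob_negatives:
  assumes S: "S \<subseteq> {..<N}" and B: "B \<subseteq> {..<n}"
  shows "(\<Sum>X\<in>Designs n N. design_prob n N p X * of_bool (negatives N n X S = B))
       = ((1 - p) ^ card S) ^ card B * (1 - (1 - p) ^ card S) ^ (n - card B)"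
  using prob_negatives_pair[OF S S B, of p] by simp

lemma sum_design_prob: "(\<Sum>X\<in>Designs n N. design_prob n N p X) = 1"
  using sum_Designs_pools[where G = "\<lambda>_. pool_prob N p"] sum_pool_prob_disjoint[of "{}" N p]
  by (simp add: design_prob_pools)

subsection \<open>The MMSE as an expected overlap\<close>

lemma Theta_eq_signal_image:
  assumes "0 < k"
  shows "Theta N k = signal k ` supports N k"
proof (intro equalityI subsetI)
  fix \<theta> assume T: "\<theta> \<in> Theta N k"
  let ?S = "{j. j < N \<and> \<theta> j \<noteq> 0}"
  have "\<theta> j = signal k ?S j" for j
    using T by (cases "j < N") (auto simp: Theta_def signal_def)
  then have "\<theta> = signal k ?S" by blast
  moreover have "?S \<in> supports N k" using T by (auto simp: supports_def Theta_def)
  ultimately show "\<theta> \<in> signal k ` supports N k" by (rule image_eqI)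
next
  fix \<theta> assume "\<theta> \<in> signal k ` supports N k"
  then obtain S where S: "S \<subseteq> {..<N}" "card S = k" "\<theta> = signal k S"
    by (auto simp: supports_def)
  then have "{j. j < N \<and> \<theta> j \<noteq> 0} = S"
    using assms by (auto simp: signal_def)
  with S show "\<theta> \<in> Theta N k" by (auto simp: Theta_def signal_def)
qed

text \<open>For \<open>k = 0\<close> the value \<open>1 / sqrt 0\<close> would be 0 by convention,
  and all signals would coincide.\<close>

lemma inj_signal: "0 < k \<Longrightarrow> inj (signal k)"
  by (rule injI) (auto simp: signal_def fun_eq_iff set_eq_iff split: if_splits)

text \<open>The inner product counts the items of \<open>S\<close> in the pool, in units of
  \<open>1 / sqrt k\<close>. It reaches the threshold as soon as one such item is present.\<close>

lemma obs_signal: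
  assumes "0 < k" "S \<subseteq> {..<N}" "X \<in> Designs n N"
  shows "obs N k n (signal k S) X = (\<lambda>i. of_bool (i < n \<and> i \<notin> negatives N n X S))"
proof
  fix i
  have "(\<Sum>j<N. X i j * signal k S j) = (\<Sum>j<N. if j \<in> pool N X i \<inter> S then 1 / sqrt (real k) else 0)"
    using assms(3) by (intro sum.cong refl) (auto simp: signal_def pool_def Designs_def)
  also have "\<dots> = real (card (pool N X i \<inter> S)) * (1 / sqrt (real k))"
    by (subst sum.inter_restrict[symmetric])
       (auto simp: pool_def intro!: arg_cong[where f = card])
  finally have *: "(\<Sum>j<N. X i j * signal k S j) = real (card (pool N X i \<inter> S)) * (1 / sqrt (real k))" .
  have fin: "finite (pool N X i \<inter> S)" by (simp add: pool_def)
  have "1 / sqrt (real k) \<le> (\<Sum>j<N. X i j * signal k S j) \<longleftrightarrow> 1 \<le> real (card (pool N X i \<inter> S))"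
    using assms(1) unfolding * by (simp add: field_simps)
  also have "\<dots> \<longleftrightarrow> pool N X i \<inter> S \<noteq> {}"
    using fin by (metis One_nat_def Suc_leI card_gt_0_iff card.empty not_one_le_zero of_nat_1 of_nat_le_iff)
  finally show "obs N k n (signal k S) X i = of_bool (i < n \<and> i \<notin> negatives N n X S)"
    by (auto simp: obs_def negatives_def)
qed

lemma obs_signal_eq_iff:
  assumes "0 < k" "S \<subseteq> {..<N}" "S' \<subseteq> {..<N}" "X \<in> Designs n N"
  shows "obs N k n (signal k S) X = obs N k n (signal k S') X \<longleftrightarrow> negatives N n X S = negatives N n X S'"
proof -
  have "i \<in> negatives N n X S \<Longrightarrow> i < n" for i S by (simp add: negatives_def)
  then show ?thesis
    unfolding obs_signal[OF assms(1,2,4)] obs_signal[OF assms(1,3,4)]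
    by (auto simp: fun_eq_iff of_bool_def set_eq_iff split: if_splits)
qed

text \<open>Deviations from the mean sum to zero, so the cross term with \<open>m\<close> drops out.
  The right-hand side is left as a difference of products because, summed over coordinates, these
  become a squared norm and an overlap.\<close>

lemma sum_sq_dev_mean:
  fixes f :: "'a \<Rightarrow> real"
  assumes "finite C" "C \<noteq> {}"
  defines "m \<equiv> (\<Sum>x\<in>C. f x) / real (card C)"
  shows "(\<Sum>x\<in>C. (f x - m)^2) = (\<Sum>x\<in>C. f x * f x - f x * m)"
proof -
  have "(\<Sum>x\<in>C. m * (f x - m)) = 0"
    using assms by (simp only: sum_distrib_left[symmetric] sum_subtractf m_def) simp
  moreover have "(f x - m)^2 = f x * f x - f x * m - m * (f x - m)" for x
    by (simp add: power2_eq_square algebra_simps)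
  ultimately show ?thesis by (simp add: sum_subtractf)
qed

lemma signal_inner:
  assumes "0 < k" "S \<subseteq> {..<N}"
  shows "(\<Sum>j<N. signal k S j * signal k S' j) = real (card (S \<inter> S')) / real k"
proof -
  have "(\<Sum>j<N. signal k S j * signal k S' j) = (\<Sum>j<N. if j \<in> S \<inter> S' then 1 / real k else 0)"
    by (intro sum.cong refl) (auto simp: signal_def)
  also have "\<dots> = real (card ({..<N} \<inter> (S \<inter> S'))) / real k"
    by (subst sum.inter_restrict[symmetric]) auto
  also have "{..<N} \<inter> (S \<inter> S') = S \<inter> S'" using assms by auto
  finally show ?thesis .
qed

lemma sum_supports_by_class:
  "(\<Sum>B\<in>Pow {..<n}. \<Sum>S\<in>consistent N k n X B. f S) = (\<Sum>S\<in>supports N k. f S)"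
  unfolding consistent_def
  by (rule sum.group) (auto simp: negatives_def)

text \<open>For a fixed design the supports are grouped by outcome. Within a class the posterior
  mean is the class average, so the total squared error is the sum of squared norms, each equal to
  1, minus inner products with that average.\<close>

lemma MMSE_eq_overlap:
  assumes k: "0 < k" and kN: "k \<le> N"
  shows "MMSE N k \<nu> n = 1 - (\<Sum>S\<in>supports N k. \<Sum>X\<in>Designs n N.
      (1 / real (N choose k)) * design_prob n N (\<nu> / real k) X * mean_overlap N k n X S)"
proof -
  let ?M = "real (N choose k)" and ?w = "design_prob n N (\<nu> / real k)"
  have M: "?M > 0" using kN by simp
  \<comment> \<open>Equal observations mean equal sets of negative tests, so \<open>signal k\<close>
    carries the consistent class bijectively onto the parameters over which \<open>post_mean\<close>
    averages.\<close>
  have pm: "post_mean N k n X (obs N k n (signal k S) X) j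
      = (\<Sum>S'\<in>consistent N k n X (negatives N n X S). signal k S' j)
          / real (card (consistent N k n X (negatives N n X S)))"
    if "S \<in> supports N k" "X \<in> Designs n N" for S X j
  proof -
    have "{\<theta>'\<in>Theta N k. obs N k n \<theta>' X = obs N k n (signal k S) X}
        = signal k ` consistent N k n X (negatives N n X S)"
      unfolding Theta_eq_signal_image[OF k] consistent_def
      using that obs_signal_eq_iff[OF k _ _ that(2)] by (auto simp: supports_def)
    moreover have "inj_on (signal k) (consistent N k n X (negatives N n X S))"
      using inj_signal[OF k] by (rule inj_on_subset) simp
    ultimately show ?thesis
      by (simp add: post_mean_def sum.reindex card_image)
  qed
  have "MMSE N k \<nu> n = (\<Sum>S\<in>supports N k. \<Sum>X\<in>Designs n N. (1 / ?M) * ?w X *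
     (\<Sum>j<N. (signal k S j - post_mean N k n X (obs N k n (signal k S) X) j)^2))"
    unfolding MMSE_def Theta_eq_signal_image[OF k]
    using inj_signal[OF k, THEN inj_on_subset, of "supports N k"]
    by (simp add: sum.reindex card_image card_supports)
  also have "\<dots> = (\<Sum>X\<in>Designs n N. (1 / ?M) * ?w X * (\<Sum>S\<in>supports N k.
     (\<Sum>j<N. (signal k S j - post_mean N k n X (obs N k n (signal k S) X) j)^2)))"
    by (subst sum.swap) (simp add: sum_distrib_left)
  also have "\<dots> = (\<Sum>X\<in>Designs n N. (1 / ?M) * ?w X * (\<Sum>S\<in>supports N k. 1 - mean_overlap N k n X S))"
  proof (rule sum.cong[OF refl])
    fix X assume X: "X \<in> Designs n N"
    have "(\<Sum>S\<in>supports N k.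
     (\<Sum>j<N. (signal k S j - post_mean N k n X (obs N k n (signal k S) X) j)^2))
     = (\<Sum>B\<in>Pow {..<n}. \<Sum>S\<in>consistent N k n X B.
     (\<Sum>j<N. (signal k S j - post_mean N k n X (obs N k n (signal k S) X) j)^2))"
      by (simp add: sum_supports_by_class)
    also have "\<dots> = (\<Sum>B\<in>Pow {..<n}. \<Sum>S\<in>consistent N k n X B. 1 - mean_overlap N k n X S)"
    proof (rule sum.cong[OF refl])
      fix B
      let ?C = "consistent N k n X B"
      let ?m = "\<lambda>j. (\<Sum>S\<in>?C. signal k S j) / real (card ?C)"
      show "(\<Sum>S\<in>?C. \<Sum>j<N. (signal k S j - post_mean N k n X (obs N k n (signal k S) X) j)^2)
          = (\<Sum>S\<in>?C. 1 - mean_overlap N k n X S)"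
      proof (cases "?C = {}")
        case False
        have "(\<Sum>S\<in>?C. \<Sum>j<N. (signal k S j - post_mean N k n X (obs N k n (signal k S) X) j)^2)
           = (\<Sum>S\<in>?C. \<Sum>j<N. (signal k S j - ?m j)^2)"
          using X by (intro sum.cong refl) (auto simp: pm consistent_def)
        also have "\<dots> = (\<Sum>j<N. \<Sum>S\<in>?C. (signal k S j - ?m j)^2)"
          by (rule sum.swap)
        also have "\<dots> = (\<Sum>j<N. \<Sum>S\<in>?C. signal k S j * signal k S j - signal k S j * ?m j)"
          using False by (intro sum.cong refl sum_sq_dev_mean) auto
        also have "\<dots> = (\<Sum>S\<in>?C. \<Sum>j<N. signal k S j * signal k S j - signal k S j * ?m j)"
          by (rule sum.swap)
        also have "\<dots> = (\<Sum>S\<in>?C. 1 - mean_overlap N k n X S)"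
        proof (rule sum.cong[OF refl])
          fix S assume S: "S \<in> ?C"
          then have SN: "S \<subseteq> {..<N}" "card S = k" "negatives N n X S = B"
            by (auto simp: consistent_def supports_def)
          have "(\<Sum>j<N. signal k S j * ?m j) = (\<Sum>S'\<in>?C. \<Sum>j<N. signal k S j * signal k S' j) / real (card ?C)"
            by (subst sum.swap) (simp add: sum_distrib_left sum_divide_distrib)
          also have "\<dots> = mean_overlap N k n X S"
            using SN by (simp add: mean_overlap_def signal_inner[OF k])
          finally show "(\<Sum>j<N. signal k S j * signal k S j - signal k S j * ?m j) = 1 - mean_overlap N k n X S"
            using k SN signal_inner[OF k SN(1), of S] by (simp add: sum_subtractf)
        qed
        finally show ?thesis .
      qed simp
    qed
    also have "\<dots> = (\<Sum>S\<in>supports N k. 1 - mean_overlap N k n X S)"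
      by (rule sum_supports_by_class)
    finally show "(1 / ?M) * ?w X * (\<Sum>S\<in>supports N k.
     (\<Sum>j<N. (signal k S j - post_mean N k n X (obs N k n (signal k S) X) j)^2)) =
      (1 / ?M) * ?w X * (\<Sum>S\<in>supports N k. 1 - mean_overlap N k n X S)" by simp
  qed
  also have "\<dots> = (\<Sum>X\<in>Designs n N. ?w X) - (\<Sum>X\<in>Designs n N. (1 / ?M) * ?w X * (\<Sum>S\<in>supports N k. mean_overlap N k n X S))"
    using M by (simp add: sum_subtractf card_supports algebra_simps diff_divide_distrib)
  also have "(\<Sum>X\<in>Designs n N. (1 / ?M) * ?w X * (\<Sum>S\<in>supports N k. mean_overlap N k n X S))
     = (\<Sum>S\<in>supports N k. \<Sum>X\<in>Designs n N. (1 / ?M) * ?w X * mean_overlap N k n X S)"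
    by (subst sum.swap) (simp add: sum_distrib_left)
  finally show ?thesis by (simp add: sum_design_prob)
qed


subsection \<open>Entropy and counting estimates\<close>

text \<open>Convexity of \<open>exp\<close>: the point \<open>(2 - t) * x\<close> is
  \<open>(1 - t) * (2 * x) + t * x\<close>.\<close>

lemma exp_interpolate:
  fixes x :: real
  assumes "0 \<le> t" "t \<le> 1"
  shows "exp ((2 - t) * x) \<le> (1 - t) * exp (2 * x) + t * exp x"
proof -
  have "convex_on UNIV (exp :: real \<Rightarrow> real)"
    by (rule f''_ge0_imp_convex[where f' = exp and f'' = exp]) (auto intro!: derivative_eq_intros)
  from convex_onD[OF this assms, of "2 * x" x] show ?thesis
    by (simp add: algebra_simps)
qed

text \<open>After division by the right-hand side, both terms are convex in \<open>t\<close>, and equality holds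
  at \<open>t = 0\<close> and \<open>t = 1\<close>; the hypothesis \<open>q \<le> 1 / 2\<close> makes the coefficient \<open>1 - 2 * q\<close> nonnegative.\<close>
lemma both_positive_prob_le:
  fixes q :: real
  assumes "0 < q" "q \<le> 1 / 2" "0 \<le> t" "t \<le> 1"
  shows "1 - 2 * q + exp ((2 - t) * ln q) \<le> exp ((2 - t) * ln (1 - q))"
proof -
  let ?c = "1 - q"
  have c: "?c > 0" using assms by simp
  let ?u = "exp ((2 - t) * (- ln ?c))" and ?v = "exp ((2 - t) * (ln q - ln ?c))"
  have e: "exp (- ln ?c) = 1 / ?c" "exp (2 * (- ln ?c)) = 1 / ?c^2"
    "exp (ln q - ln ?c) = q / ?c" "exp (2 * (ln q - ln ?c)) = q^2 / ?c^2"
    using assms c by (simp_all add: exp_minus exp_diff exp_double divide_simps power_divide)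
  have "?u \<le> (1 - t) * (1 / ?c^2) + t * (1 / ?c)"
    using exp_interpolate[OF assms(3,4), of "- ln ?c"] unfolding e .
  then have "(1 - 2 * q) * ?u \<le> (1 - 2 * q) * ((1 - t) * (1 / ?c^2) + t * (1 / ?c))"
    using assms by (intro mult_left_mono) auto
  moreover have "?v \<le> (1 - t) * (q^2 / ?c^2) + t * (q / ?c)"
    using exp_interpolate[OF assms(3,4), of "ln q - ln ?c"] unfolding e .
  moreover have "(1 - 2 * q) * ((1 - t) * (1 / ?c^2) + t * (1 / ?c)) + ((1 - t) * (q^2 / ?c^2) + t * (q / ?c)) = 1"
    using c by (simp add: divide_simps) (simp add: power2_eq_square algebra_simps)
  ultimately have "(1 - 2 * q) * ?u + ?v \<le> 1" by linarith
  then have "((1 - 2 * q) * ?u + ?v) * exp ((2 - t) * ln ?c) \<le> 1 * exp ((2 - t) * ln ?c)"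
    by (rule mult_right_mono) simp
  moreover have "?u * exp ((2 - t) * ln ?c) = 1" "?v * exp ((2 - t) * ln ?c) = exp ((2 - t) * ln q)"
    by (simp_all flip: exp_add add: algebra_simps)
  ultimately show ?thesis
    by (simp add: algebra_simps)
qed

text \<open>The law of the set of negative tests when each of \<open>n\<close> independent tests is
  negative with probability \<open>q\<close>.\<close>

definition outcome_prob :: "real \<Rightarrow> nat \<Rightarrow> nat set \<Rightarrow> real" where
  "outcome_prob q n B = q ^ card B * (1 - q) ^ (n - card B)"

lemma sum_outcome_prob: "(\<Sum>B\<in>Pow {..<n}. outcome_prob q n B) = 1"
proof -
  have "(\<Prod>i<n. q + (1 - q)) = (\<Sum>B\<in>Pow {..<n}. outcome_prob q n B)"
    by (subst prod_add) (auto intro!: sum.cong simp: outcome_prob_def card_Diff_subset finite_subset)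
  then show ?thesis by simp
qed

text \<open>Conditioning on the last test: a subset of \<open>{..<Suc n}\<close> either contains
  \<open>n\<close> or does not.\<close>

lemma sum_outcome_prob_Suc:
  "(\<Sum>B\<in>Pow {..<Suc n}. outcome_prob q (Suc n) B * f (card B))
     = (\<Sum>B\<in>Pow {..<n}. outcome_prob q n B * (q * f (Suc (card B)) + (1 - q) * f (card B)))"
proof -
  have fin: "finite B" "n \<notin> B" "card B \<le> n" if "B \<in> Pow {..<n}" for B
    using that finite_subset[of B "{..<n}"] card_mono[of "{..<n}" B] by auto
  have inj: "inj_on (insert n) (Pow {..<n})"
    by (rule inj_onI) (metis fin(2) insert_ident)
  have "(\<Sum>B\<in>Pow {..<Suc n}. outcome_prob q (Suc n) B * f (card B))
    = (\<Sum>B\<in>Pow {..<n}. outcome_prob q (Suc n) B * f (card B))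
      + (\<Sum>B\<in>insert n ` Pow {..<n}. outcome_prob q (Suc n) B * f (card B))"
    unfolding lessThan_Suc Pow_insert by (rule sum.union_disjoint) auto
  also have "(\<Sum>B\<in>insert n ` Pow {..<n}. outcome_prob q (Suc n) B * f (card B))
     = (\<Sum>B\<in>Pow {..<n}. outcome_prob q n B * (q * f (Suc (card B))))"
    by (subst sum.reindex[OF inj]) (auto intro!: sum.cong simp: outcome_prob_def fin)
  also have "(\<Sum>B\<in>Pow {..<n}. outcome_prob q (Suc n) B * f (card B))
     = (\<Sum>B\<in>Pow {..<n}. outcome_prob q n B * ((1 - q) * f (card B)))"
    by (intro sum.cong refl) (auto simp: outcome_prob_def fin Suc_diff_le)
  finally show ?thesis by (simp add: sum.distrib distrib_left)
qed

text \<open>The binomial variance, by induction: the centred contribution of the new test has mean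
  zero, so it adds only its own variance \<open>q * (1 - q)\<close>.\<close>

lemma outcome_variance:
  "(\<Sum>B\<in>Pow {..<n}. outcome_prob q n B * (real (card B) - q * real n)^2) = real n * (q * (1 - q))"
proof (induction n)
  case (Suc n)
  have "q * (real (Suc c) - q * real (Suc n))^2 + (1 - q) * (real c - q * real (Suc n))^2
      = (real c - q * real n)^2 + q * (1 - q)" for c
    by (simp add: power2_eq_square algebra_simps)
  then have "(\<Sum>B\<in>Pow {..<Suc n}. outcome_prob q (Suc n) B * (real (card B) - q * real (Suc n))^2)
     = (\<Sum>B\<in>Pow {..<n}. outcome_prob q n B * ((real (card B) - q * real n)^2 + q * (1 - q)))"
    by (subst sum_outcome_prob_Suc) simp
  also have "\<dots> = real n * (q * (1 - q)) + q * (1 - q)"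
    using Suc sum_outcome_prob[of q n]
    by (simp add: distrib_left sum.distrib flip: sum_distrib_right)
  finally show ?case by (simp add: algebra_simps)
qed (simp add: outcome_prob_def)

text \<open>A support is determined by its part inside \<open>S\<close>, for which there are at most
  \<open>2 ^ k\<close> choices, and its part outside, which has \<open>k - l\<close> elements. The
  crude factor \<open>2 ^ k\<close> is harmless later because \<open>k\<close> is of smaller order
  than \<open>ln (N choose k)\<close>.\<close>

lemma card_overlap_le:
  assumes "S \<in> supports N k" "l \<le> k"
  shows "card {S' \<in> supports N k. card (S \<inter> S') = l} \<le> 2 ^ k * (N choose (k - l))"
proof -
  have S: "finite S" "card S = k" "S \<subseteq> {..<N}"
    using assms finite_subset[of S "{..<N}"] by (auto simp: supports_def)
  let ?A = "{S' \<in> supports N k. card (S \<inter> S') = l}"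
  let ?f = "\<lambda>S'. (S \<inter> S', S' - S)"
  have "?f ` ?A \<subseteq> Pow S \<times> supports N (k - l)"
  proof
    fix y assume "y \<in> ?f ` ?A"
    then obtain S' where S': "S' \<in> supports N k" "card (S \<inter> S') = l" "y = ?f S'" by auto
    then have "finite S'" using finite_subset[of S' "{..<N}"] by (auto simp: supports_def)
    then have "card (S' - S) = k - l"
      using S' card_Diff_subset_Int[of S' S] S by (simp add: supports_def Int_commute)
    then show "y \<in> Pow S \<times> supports N (k - l)" using S' by (auto simp: supports_def)
  qed
  moreover have "inj_on ?f ?A" by (rule inj_onI) auto
  ultimately have "card ?A \<le> card (Pow S \<times> supports N (k - l))"
    using S by (intro card_inj_on_le) auto
  then show ?thesis using S by (simp add: card_cartesian_product card_Pow card_supports)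
qed

lemma power_div_fact_le_exp:
  fixes x :: real
  assumes "0 \<le> x"
  shows "x ^ m / fact m \<le> exp x"
proof -
  have "(\<Sum>i\<in>{m}. x ^ i /\<^sub>R fact i) \<le> (\<Sum>i. x ^ i /\<^sub>R fact i)"
    using assms by (intro sum_le_suminf summable_exp_generic) auto
  then show ?thesis by (simp add: exp_def divide_inverse mult.commute)
qed

text \<open>From \<open>N ^ m / fact m\<close>, with \<open>k ^ m / fact m\<close> bounded by
  \<open>exp k\<close>. The base \<open>N / k\<close> does not depend on \<open>m\<close>, so with
  \<open>m = k - l\<close> the logarithm of the bound is affine in the overlap
  \<open>l\<close>.\<close>

lemma binomial_le_exp:
  assumes "0 < k" "0 < N"
  shows "real (N choose m) \<le> exp (real k) * (real N / real k) ^ m"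
proof -
  have "real (N choose m) * fact m \<le> real N ^ m"
    by (metis binomial_fact_pow of_nat_fact of_nat_le_iff of_nat_mult of_nat_power)
  then have "real (N choose m) \<le> real N ^ m / fact m"
    by (simp add: pos_le_divide_eq)
  also have "\<dots> = (real k ^ m / fact m) * (real N / real k) ^ m"
    using assms by (simp add: power_divide)
  also have "\<dots> \<le> exp (real k) * (real N / real k) ^ m"
    by (intro mult_right_mono power_div_fact_le_exp) auto
  finally show ?thesis .
qed

lemma ln_binomial_bounds:
  assumes "0 < k" "k \<le> N"
  shows "real k * ln (real N / real k) \<le> ln (real (N choose k))"
    and "ln (real (N choose k)) \<le> real k * ln (real N / real k) + real k"
proof -
  have pos: "real N / real k > 0" "real (N choose k) > 0" using assms by auto
  have "(real N / real k) ^ k \<le> real (N choose k)"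
    using assms by (rule_tac binomial_ge_n_over_k_pow_k)
  then have "ln ((real N / real k) ^ k) \<le> ln (real (N choose k))"
    using pos by (subst ln_le_cancel_iff) auto
  then show "real k * ln (real N / real k) \<le> ln (real (N choose k))"
    using pos(1) by (simp add: ln_realpow)
  have "ln (real (N choose k)) \<le> ln (exp (real k) * (real N / real k) ^ k)"
    using binomial_le_exp[of k N k] assms pos by (subst ln_le_cancel_iff) auto
  then show "ln (real (N choose k)) \<le> real k * ln (real N / real k) + real k"
    using pos(1) assms by (simp add: ln_mult ln_realpow)
qed

text \<open>One \<open>exp k\<close> absorbs \<open>2 ^ k\<close>, the other comes from
  \<open>binomial_le_exp\<close>. Writing \<open>k - l\<close> as \<open>(1 - l / k) * k\<close> and
  using the lower bound on \<open>ln (N choose k)\<close> expresses the rest through that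
  logarithm.\<close>

lemma card_overlap_le_exp:
  assumes S: "S \<in> supports N k" and l: "l \<le> k" and k: "0 < k" "k \<le> N"
  shows "real (card {S' \<in> supports N k. card (S \<inter> S') = l})
     \<le> exp (2 * real k + (1 - real l / real k) * ln (real (N choose k)))"
proof -
  let ?x = "ln (real N / real k)"
  have "real (card {S' \<in> supports N k. card (S \<inter> S') = l}) \<le> 2 ^ k * real (N choose (k - l))"
    using of_nat_mono[OF card_overlap_le[OF S l], where 'a = real] by simp
  also have "\<dots> \<le> exp (real k) * (exp (real k) * exp (real (k - l) * ?x))"
  proof (rule mult_mono)
    have "(2::real) ^ k \<le> exp 1 ^ k" using exp_ge_add_one_self[of 1] by (intro power_mono) auto
    then show "2 ^ k \<le> exp (real k)" by (simp flip: exp_of_nat_mult)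
    show "real (N choose (k - l)) \<le> exp (real k) * exp (real (k - l) * ?x)"
      using binomial_le_exp[of k N "k - l"] k by (simp add: exp_of_nat_mult)
  qed auto
  also have "\<dots> = exp (2 * real k + (1 - real l / real k) * (real k * ?x))"
    using k l by (simp flip: exp_add add: of_nat_diff) (simp add: field_simps)
  also have "\<dots> \<le> exp (2 * real k + (1 - real l / real k) * ln (real (N choose k)))"
    using ln_binomial_bounds(1)[OF k] l k by (auto intro!: mult_left_mono)
  finally show ?thesis .
qed

lemma outcome_prob_pos: "0 < q \<Longrightarrow> q < 1 \<Longrightarrow> 0 < outcome_prob q n B"
  by (simp add: outcome_prob_def)

subsection \<open>Expected number of consistent supports\<close>

text \<open>Here \<open>q\<close> is the probability that a random pool misses a given support of
  size \<open>k\<close>, that is, that a test is negative.\<close>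

locale bernoulli_group_testing =
  fixes N k n :: nat and \<nu> q :: real
  assumes k_pos: "0 < k" and k_le: "k \<le> N"
    and nu_nonneg: "0 \<le> \<nu>" and nu_le: "\<nu> \<le> real k"
    and q_eq: "(1 - \<nu> / real k) ^ k = q" and q_pos: "0 < q" and q_le: "q \<le> 1 / 2"
begin

abbreviation "w \<equiv> design_prob n N (\<nu> / real k)"

definition typical :: "real \<Rightarrow> nat set \<Rightarrow> bool" where
  "typical D B \<longleftrightarrow> B \<subseteq> {..<n} \<and> \<bar>real (card B) - q * real n\<bar> \<le> D"

text \<open>Typicality is built into the event because the collision bound in terms of
  \<open>H\<close> is available only for outcomes with about \<open>q * n\<close> negatives.\<close>

definition agree :: "real \<Rightarrow> nat set \<Rightarrow> nat set \<Rightarrow> (nat \<Rightarrow> nat \<Rightarrow> real) \<Rightarrow> bool" where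
  "agree D S S' X \<longleftrightarrow> typical D (negatives N n X S) \<and> negatives N n X S' = negatives N n X S"

text \<open>The error in the log-probability of an outcome caused by a deviation of at most
  \<open>D\<close> in the number of negatives.\<close>

definition slack :: "real \<Rightarrow> real" where
  "slack D = - ln q * D"

abbreviation "L \<equiv> ln (real (N choose k))"
abbreviation "H \<equiv> real n * bin_entropy q"

lemma w_nonneg: "0 \<le> w X"
  using nu_nonneg nu_le k_pos by (intro design_prob_nonneg) auto

text \<open>The log-probability is affine in \<open>card B\<close>, equals \<open>- H\<close> at
  \<open>card B = q * n\<close>, and has slope \<open>ln q - ln (1 - q)\<close>, of modulus at most
  \<open>- ln q\<close> since \<open>q \<le> 1 / 2\<close>.\<close>

lemma typical_outcome_prob:
  assumes "typical D B"
  shows "ln (outcome_prob q n B) \<le> slack D - H" "- slack D - H \<le> ln (outcome_prob q n B)"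
proof -
  have B: "card B \<le> n" "\<bar>real (card B) - q * real n\<bar> \<le> D"
    using assms card_mono[of "{..<n}" B] by (auto simp: typical_def)
  have "ln (outcome_prob q n B) = real (card B) * ln q + (real n - real (card B)) * ln (1 - q)"
    using q_pos q_le B(1) by (simp add: outcome_prob_def ln_mult ln_realpow of_nat_diff)
  also have "\<dots> = - H + (real (card B) - q * real n) * (ln q - ln (1 - q))"
    by (simp add: bin_entropy_def algebra_simps)
  finally have eq: "ln (outcome_prob q n B) = - H + (real (card B) - q * real n) * (ln q - ln (1 - q))" .
  have "ln q \<le> ln (1 - q)" "ln (1 - q) \<le> 0" using q_pos q_le by auto
  then have "\<bar>ln q - ln (1 - q)\<bar> \<le> - ln q" by linarith
  then have "\<bar>(real (card B) - q * real n) * (ln q - ln (1 - q))\<bar> \<le> D * (- ln q)"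
    unfolding abs_mult using B(2) by (intro mult_mono) auto
  then have "\<bar>(real (card B) - q * real n) * (ln q - ln (1 - q))\<bar> \<le> slack D"
    by (simp add: slack_def mult.commute)
  with eq show "ln (outcome_prob q n B) \<le> slack D - H" "- slack D - H \<le> ln (outcome_prob q n B)"
    by linarith+
qed

lemma finite_typical: "finite {B. typical D B}"
  by (rule finite_subset[of _ "Pow {..<n}"]) (auto simp: typical_def)

text \<open>Every typical outcome has mass at least \<open>exp (- slack D - H)\<close>, and the
  total mass is 1.\<close>

lemma card_typical_le: "real (card {B. typical D B}) \<le> exp (H + slack D)"
proof -
  have pos: "0 < outcome_prob q n B" for B using q_pos q_le by (intro outcome_prob_pos) auto
  have "real (card {B. typical D B}) * exp (- slack D - H) = (\<Sum>B\<in>{B. typical D B}. exp (- slack D - H))"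
    by simp
  also have "\<dots> \<le> (\<Sum>B\<in>{B. typical D B}. outcome_prob q n B)"
  proof (rule sum_mono)
    fix B assume "B \<in> {B. typical D B}"
    then have "exp (- slack D - H) \<le> exp (ln (outcome_prob q n B))"
      using typical_outcome_prob(2)[of D B] by simp
    then show "exp (- slack D - H) \<le> outcome_prob q n B" using pos[of B] by simp
  qed
  also have "\<dots> \<le> (\<Sum>B\<in>Pow {..<n}. outcome_prob q n B)"
    using pos by (intro sum_mono2) (auto simp: typical_def less_imp_le)
  also have "\<dots> = 1" by (rule sum_outcome_prob)
  finally have "real (card {B. typical D B}) * exp (- slack D - H) * exp (H + slack D) \<le> 1 * exp (H + slack D)"
    by (rule mult_right_mono) simp
  then show ?thesis by (simp add: mult.assoc flip: exp_add)
qed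

lemma q_exp: "0 < 1 - \<nu> / real k" "ln (1 - \<nu> / real k) = ln q / real k"
proof -
  have "0 \<le> 1 - \<nu> / real k" using nu_le k_pos by simp
  moreover have "1 - \<nu> / real k \<noteq> 0" using q_eq q_pos k_pos by (auto simp: power_0_left)
  ultimately show pos: "0 < 1 - \<nu> / real k" by linarith
  have "ln q = real k * ln (1 - \<nu> / real k)"
    unfolding q_eq[symmetric] using pos by (simp add: ln_realpow)
  then show "ln (1 - \<nu> / real k) = ln q / real k" using k_pos by simp
qed

text \<open>For overlap fraction \<open>t\<close> the union has \<open>(2 - t) * k\<close> elements,
  so the probability that both supports produce \<open>B\<close> is at most the power
  \<open>2 - t\<close> of \<open>outcome_prob q n B\<close>. One factor \<open>outcome_prob\<close>
  is kept and sums to at most 1 over \<open>B\<close>; the remaining power \<open>1 - t\<close> is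
  bounded by typicality.\<close>

lemma prob_agree_le:
  assumes S: "S \<in> supports N k" and S': "S' \<in> supports N k"
  shows "(\<Sum>X\<in>Designs n N. w X * of_bool (agree D S S' X))
      \<le> exp ((1 - real (card (S \<inter> S')) / real k) * (slack D - H))"
proof -
  define t where "t = real (card (S \<inter> S')) / real k"
  define r where "r = (1 - \<nu> / real k) ^ card (S \<union> S')"
  have SN: "S \<subseteq> {..<N}" "S' \<subseteq> {..<N}" "card S = k" "card S' = k"
    using S S' by (auto simp: supports_def)
  have fin: "finite S" "finite S'" using SN finite_subset by auto
  have t: "0 \<le> t" "t \<le> 1"
    using SN fin k_pos card_mono[of S "S \<inter> S'"] by (auto simp: t_def)
  have "card (S \<union> S') + card (S \<inter> S') = 2 * k"
    using card_Un_Int[OF fin] SN by simp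
  then have "real (card (S \<union> S')) + real (card (S \<inter> S')) = 2 * real k"
    by (metis of_nat_add of_nat_mult of_nat_numeral)
  then have cU: "real (card (S \<union> S')) = (2 - t) * real k"
    using k_pos by (simp add: t_def left_diff_distrib)
  have r: "r = exp ((2 - t) * ln q)"
  proof -
    have "r = exp (real (card (S \<union> S')) * ln (1 - \<nu> / real k))"
      using q_exp(1) by (simp add: r_def exp_of_nat_mult)
    also have "\<dots> = exp ((2 - t) * ln q)"
      using k_pos unfolding cU q_exp(2) by simp
    finally show ?thesis .
  qed
  have rq: "1 - 2 * q + r \<le> exp ((2 - t) * ln (1 - q))"
    unfolding r using q_pos q_le t by (rule both_positive_prob_le)
  have nonneg: "0 \<le> 1 - 2 * q + r" using q_le by (simp add: r)
  have class_le: "r ^ card B * (1 - 2 * q + r) ^ (n - card B)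
      \<le> outcome_prob q n B * exp ((1 - t) * (slack D - H))" if B: "typical D B" for B
  proof -
    have pos: "0 < outcome_prob q n B" using q_pos q_le by (intro outcome_prob_pos) auto
    have "r ^ card B * (1 - 2 * q + r) ^ (n - card B)
        \<le> exp ((2 - t) * ln q) ^ card B * exp ((2 - t) * ln (1 - q)) ^ (n - card B)"
      unfolding r[symmetric] using rq nonneg by (intro mult_left_mono power_mono) (auto simp: r)
    also have "\<dots> = exp ((2 - t) * ln (outcome_prob q n B))"
      using q_pos q_le
      by (simp add: outcome_prob_def ln_mult ln_realpow algebra_simps flip: exp_of_nat_mult exp_add)
    also have "\<dots> = outcome_prob q n B * exp ((1 - t) * ln (outcome_prob q n B))"
    proof -
      have "(2 - t) * ln (outcome_prob q n B)
          = ln (outcome_prob q n B) + (1 - t) * ln (outcome_prob q n B)"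
        by (simp add: algebra_simps)
      then show ?thesis using pos by (simp only: exp_add exp_ln)
    qed
    also have "\<dots> \<le> outcome_prob q n B * exp ((1 - t) * (slack D - H))"
      using typical_outcome_prob(1)[OF B] t pos by (auto intro!: mult_left_mono)
    finally show ?thesis .
  qed
  have "(\<Sum>X\<in>Designs n N. w X * of_bool (agree D S S' X))
     = (\<Sum>X\<in>Designs n N. \<Sum>B\<in>{B. typical D B}.
          w X * of_bool (negatives N n X S = B \<and> negatives N n X S' = B))"
  proof (rule sum.cong[OF refl])
    fix X
    \<comment> \<open>At most one \<open>B\<close> contributes, namely the outcome that
      \<open>S\<close> produces under \<open>X\<close>.\<close>
    have "(\<Sum>B\<in>{B. typical D B}. w X * of_bool (negatives N n X S = B \<and> negatives N n X S' = B))
       = (\<Sum>B\<in>{B. typical D B}. if negatives N n X S = B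
            then w X * of_bool (negatives N n X S' = negatives N n X S) else 0)"
      by (intro sum.cong refl) auto
    also have "\<dots> = w X * of_bool (agree D S S' X)"
      using finite_typical by (simp add: sum.delta' agree_def)
    finally show "w X * of_bool (agree D S S' X) = (\<Sum>B\<in>{B. typical D B}.
          w X * of_bool (negatives N n X S = B \<and> negatives N n X S' = B))" by simp
  qed
  also have "\<dots> = (\<Sum>B\<in>{B. typical D B}. \<Sum>X\<in>Designs n N.
          w X * of_bool (negatives N n X S = B \<and> negatives N n X S' = B))"
    by (rule sum.swap)
  also have "\<dots> = (\<Sum>B\<in>{B. typical D B}. r ^ card B * (1 - 2 * q + r) ^ (n - card B))"
  proof (rule sum.cong[OF refl])
    fix B assume "B \<in> {B. typical D B}"
    then have "B \<subseteq> {..<n}" by (simp add: typical_def)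
    moreover have "1 - q - q + r = 1 - 2 * q + r" by simp
    ultimately show "(\<Sum>X\<in>Designs n N. w X * of_bool (negatives N n X S = B \<and> negatives N n X S' = B))
        = r ^ card B * (1 - 2 * q + r) ^ (n - card B)"
      using prob_negatives_pair[OF SN(1,2), of B n "\<nu> / real k"] by (simp add: SN q_eq r_def)
  qed
  also have "\<dots> \<le> (\<Sum>B\<in>{B. typical D B}. outcome_prob q n B * exp ((1 - t) * (slack D - H)))"
    using class_le by (intro sum_mono) auto
  also have "\<dots> = (\<Sum>B\<in>{B. typical D B}. outcome_prob q n B) * exp ((1 - t) * (slack D - H))"
    by (simp add: sum_distrib_right)
  also have "\<dots> \<le> 1 * exp ((1 - t) * (slack D - H))"
  proof (rule mult_right_mono)
    have "(\<Sum>B\<in>{B. typical D B}. outcome_prob q n B) \<le> (\<Sum>B\<in>Pow {..<n}. outcome_prob q n B)"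
      using q_pos q_le by (intro sum_mono2) (auto simp: typical_def outcome_prob_def)
    then show "(\<Sum>B\<in>{B. typical D B}. outcome_prob q n B) \<le> 1" by (simp add: sum_outcome_prob)
  qed simp
  finally show ?thesis by (simp add: t_def)
qed

text \<open>The count and the collision probability at overlap \<open>l\<close> multiply to an
  exponent proportional to \<open>1 - l / k\<close>, and there are at most \<open>k + 1\<close>
  values of \<open>l\<close>. The range \<open>P\<close> is left open because one regime needs small
  overlaps and the other large ones.\<close>

lemma expected_agreeing_le:
  assumes S: "S \<in> supports N k"
    and b: "\<And>l. l \<le> k \<Longrightarrow> P l \<Longrightarrow> (1 - real l / real k) * (L + slack D - H) \<le> b"
  shows "(\<Sum>X\<in>Designs n N. w X * (\<Sum>S'\<in>{S' \<in> supports N k. P (card (S \<inter> S'))}. of_bool (agree D S S' X)))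
      \<le> (real k + 1) * exp (2 * real k + b)"
proof -
  let ?A = "{S' \<in> supports N k. P (card (S \<inter> S'))}"
  let ?I = "{l. l \<le> k \<and> P l}"
  have finS: "finite S" "card S = k"
    using S finite_subset[of S "{..<N}"] by (auto simp: supports_def)
  have "(\<Sum>X\<in>Designs n N. w X * (\<Sum>S'\<in>?A. of_bool (agree D S S' X)))
      = (\<Sum>S'\<in>?A. \<Sum>X\<in>Designs n N. w X * of_bool (agree D S S' X))"
    by (subst sum.swap) (simp only: sum_distrib_left)
  also have "\<dots> \<le> (\<Sum>S'\<in>?A. exp ((1 - real (card (S \<inter> S')) / real k) * (slack D - H)))"
    using prob_agree_le[OF S] by (intro sum_mono) auto
  also have "\<dots> = (\<Sum>l\<in>?I. \<Sum>S'\<in>{S' \<in> ?A. card (S \<inter> S') = l}.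
                    exp ((1 - real (card (S \<inter> S')) / real k) * (slack D - H)))"
  proof (rule sum.group[symmetric])
    show "(\<lambda>S'. card (S \<inter> S')) ` ?A \<subseteq> ?I"
      using card_mono[OF finS(1), of "S \<inter> _"] finS(2) by auto
  qed auto
  also have "\<dots> \<le> (\<Sum>l\<in>?I. exp (2 * real k + b))"
  proof (rule sum_mono)
    fix l assume l: "l \<in> ?I"
    have "(\<Sum>S'\<in>{S' \<in> ?A. card (S \<inter> S') = l}. exp ((1 - real (card (S \<inter> S')) / real k) * (slack D - H)))
       = (\<Sum>S'\<in>{S' \<in> supports N k. card (S \<inter> S') = l}. exp ((1 - real l / real k) * (slack D - H)))"
      using l by (intro sum.cong) auto
    also have "\<dots> = real (card {S' \<in> supports N k. card (S \<inter> S') = l}) * exp ((1 - real l / real k) * (slack D - H))"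
      by simp
    also have "\<dots> \<le> exp (2 * real k + (1 - real l / real k) * L) * exp ((1 - real l / real k) * (slack D - H))"
      using card_overlap_le_exp[OF S _ k_pos k_le] l by (intro mult_right_mono) auto
    also have "\<dots> = exp (2 * real k + (1 - real l / real k) * (L + slack D - H))"
      by (simp add: algebra_simps flip: exp_add)
    also have "\<dots> \<le> exp (2 * real k + b)" using b l by simp
    finally show "(\<Sum>S'\<in>{S' \<in> ?A. card (S \<inter> S') = l}. exp ((1 - real (card (S \<inter> S')) / real k) * (slack D - H)))
        \<le> exp (2 * real k + b)" .
  qed
  also have "\<dots> \<le> (real k + 1) * exp (2 * real k + b)"
  proof -
    have "card ?I \<le> card {..k}" by (intro card_mono) auto
    then show ?thesis by (auto intro!: mult_right_mono)
  qed
  finally show ?thesis .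
qed

text \<open>Chebyshev's inequality, with the variance \<open>n * q * (1 - q)\<close> bounded by
  \<open>n\<close>.\<close>

lemma prob_atypical_le:
  assumes S: "S \<in> supports N k" and D: "0 < D"
  shows "(\<Sum>X\<in>Designs n N. w X * of_bool (\<not> typical D (negatives N n X S))) \<le> real n / D^2"
proof -
  let ?A = "{B. B \<subseteq> {..<n} \<and> \<not> typical D B}"
  have fin: "finite ?A" by (rule finite_subset[of _ "Pow {..<n}"]) auto
  have SN: "S \<subseteq> {..<N}" "card S = k" using S by (auto simp: supports_def)
  have pos: "0 < outcome_prob q n B" for B using q_pos q_le by (intro outcome_prob_pos) auto
  have "(\<Sum>X\<in>Designs n N. w X * of_bool (\<not> typical D (negatives N n X S)))
     = (\<Sum>X\<in>Designs n N. \<Sum>B\<in>?A. w X * of_bool (negatives N n X S = B))"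
  proof (rule sum.cong[OF refl])
    fix X
    have "(\<Sum>B\<in>?A. w X * of_bool (negatives N n X S = B))
       = (\<Sum>B\<in>?A. if negatives N n X S = B then w X else 0)"
      by (intro sum.cong refl) simp
    also have "\<dots> = w X * of_bool (\<not> typical D (negatives N n X S))"
      by (subst sum.delta'[OF fin]) (auto simp: negatives_def)
    finally show "w X * of_bool (\<not> typical D (negatives N n X S))
      = (\<Sum>B\<in>?A. w X * of_bool (negatives N n X S = B))" by (rule sym)
  qed
  also have "\<dots> = (\<Sum>B\<in>?A. \<Sum>X\<in>Designs n N. w X * of_bool (negatives N n X S = B))"
    by (rule sum.swap)
  also have "\<dots> = (\<Sum>B\<in>?A. outcome_prob q n B)"
    using prob_negatives[OF SN(1), of _ n "\<nu> / real k"]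
    by (intro sum.cong refl) (auto simp: SN q_eq outcome_prob_def)
  also have "\<dots> \<le> (\<Sum>B\<in>?A. outcome_prob q n B * (real (card B) - q * real n)^2 / D^2)"
  proof (rule sum_mono)
    fix B assume "B \<in> ?A"
    then have "D < \<bar>real (card B) - q * real n\<bar>" by (auto simp: typical_def)
    then have "D^2 \<le> (real (card B) - q * real n)^2"
      using D by (metis abs_of_pos less_imp_le power2_abs power_mono)
    then have "1 \<le> (real (card B) - q * real n)^2 / D^2" using D by simp
    then show "outcome_prob q n B \<le> outcome_prob q n B * (real (card B) - q * real n)^2 / D^2"
      using mult_left_mono[OF _ less_imp_le[OF pos[of B]]] by fastforce
  qed
  also have "\<dots> \<le> (\<Sum>B\<in>Pow {..<n}. outcome_prob q n B * (real (card B) - q * real n)^2 / D^2)"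
    using pos by (intro sum_mono2) (auto simp: less_imp_le)
  also have "\<dots> = real n * (q * (1 - q)) / D^2"
    by (simp add: outcome_variance flip: sum_divide_distrib)
  also have "\<dots> \<le> real n * 1 / D^2"
  proof -
    have "q * (1 - q) \<le> 1" using q_pos q_le mult_le_one[of q "1 - q"] by simp
    then show ?thesis by (intro divide_right_mono mult_left_mono) auto
  qed
  finally show ?thesis by simp
qed

subsection \<open>Finite-size bounds on the MMSE\<close>

lemma overlap_frac_bounds:
  assumes "S \<in> supports N k"
  shows "0 \<le> real (card (S \<inter> S')) / real k" "real (card (S \<inter> S')) / real k \<le> 1"
proof -
  have "finite S" "card S = k"
    using assms finite_subset[of S "{..<N}"] by (auto simp: supports_def)
  then show "0 \<le> real (card (S \<inter> S')) / real k" "real (card (S \<inter> S')) / real k \<le> 1"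
    using card_mono[of S "S \<inter> S'"] k_pos by auto
qed

lemma mean_overlap_nonneg: "0 \<le> mean_overlap N k n X S"
  unfolding mean_overlap_def by (intro divide_nonneg_nonneg sum_nonneg) auto

lemma self_consistent: "S \<in> supports N k \<Longrightarrow> S \<in> consistent N k n X (negatives N n X S)"
  by (simp add: consistent_def)

text \<open>If the outcome is atypical or some support of low overlap agrees, the right-hand side is
  already at least 1. Otherwise every consistent support has overlap at least
  \<open>1 - \<epsilon>\<close>, hence so does the average.\<close>

lemma mean_overlap_ge:
  assumes S: "S \<in> supports N k" and \<epsilon>: "0 < \<epsilon>"
  shows "1 - mean_overlap N k n X S \<le> \<epsilon> + of_bool (\<not> typical D (negatives N n X S))
     + (\<Sum>S'\<in>{S' \<in> supports N k. real (card (S \<inter> S')) / real k < 1 - \<epsilon>}. of_bool (agree D S S' X))"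
    (is "_ \<le> _ + _ + (\<Sum>S'\<in>?A. _)")
proof -
  let ?C = "consistent N k n X (negatives N n X S)"
  have C: "0 < real (card ?C)" using self_consistent[OF S] by (auto simp: card_gt_0_iff)
  have finA: "finite ?A" by simp
  have nonneg: "0 \<le> (\<Sum>S'\<in>?A. of_bool (agree D S S' X) :: real)" by (intro sum_nonneg) auto
  consider "\<not> typical D (negatives N n X S)"
    | S' where "S' \<in> ?A" "agree D S S' X"
    | "typical D (negatives N n X S)" "\<And>S'. S' \<in> ?A \<Longrightarrow> \<not> agree D S S' X" by blast
  then show ?thesis
  proof cases
    case 1
    then show ?thesis using mean_overlap_nonneg[of X S] nonneg \<epsilon> by simp
  next
    case 2
    have "(of_bool (agree D S S' X) :: real) \<le> (\<Sum>S'\<in>?A. of_bool (agree D S S' X))"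
      using 2(1) by (intro member_le_sum) auto
    then have "1 \<le> (\<Sum>S'\<in>?A. of_bool (agree D S S' X) :: real)" using 2(2) by simp
    moreover have "0 \<le> (of_bool (\<not> typical D (negatives N n X S)) :: real)" by simp
    ultimately show ?thesis using mean_overlap_nonneg[of X S] \<epsilon> by linarith
  next
    case 3
    have "1 - \<epsilon> \<le> real (card (S \<inter> S')) / real k" if "S' \<in> ?C" for S'
      using 3(2)[of S'] 3(1) that by (fastforce simp: consistent_def agree_def not_less)
    then have "(\<Sum>S'\<in>?C. 1 - \<epsilon>) \<le> (\<Sum>S'\<in>?C. real (card (S \<inter> S')) / real k)"
      by (rule sum_mono)
    then have "1 - \<epsilon> \<le> mean_overlap N k n X S"
      using C unfolding mean_overlap_def by (simp add: pos_le_divide_eq mult.commute)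
    then show ?thesis using nonneg by simp
  qed
qed

text \<open>On a typical outcome whose class exceeds \<open>z\<close>, members of overlap at most
  \<open>\<epsilon>\<close> contribute at most \<open>\<epsilon>\<close> to the average, and the
  others at most their number divided by \<open>z\<close>. In the remaining cases an indicator makes
  the right-hand side at least 1.\<close>

lemma mean_overlap_le:
  assumes S: "S \<in> supports N k" and \<epsilon>: "0 < \<epsilon>" and z: "0 < z"
  shows "mean_overlap N k n X S \<le> \<epsilon> + of_bool (\<not> typical D (negatives N n X S))
     + of_bool (typical D (negatives N n X S) \<and> real (card (consistent N k n X (negatives N n X S))) \<le> z)
     + (\<Sum>S'\<in>{S' \<in> supports N k. \<epsilon> < real (card (S \<inter> S')) / real k}. of_bool (agree D S S' X)) / z"
    (is "_ \<le> _ + _ + _ + (\<Sum>S'\<in>?A. _) / z")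
proof -
  let ?C = "consistent N k n X (negatives N n X S)"
  let ?o = "\<lambda>S'. real (card (S \<inter> S')) / real k"
  have C: "0 < real (card ?C)" using self_consistent[OF S] by (auto simp: card_gt_0_iff)
  have nonneg: "0 \<le> (\<Sum>S'\<in>?A. of_bool (agree D S S' X) :: real)" by (intro sum_nonneg) auto
  have le1: "mean_overlap N k n X S \<le> 1"
  proof -
    have "(\<Sum>S'\<in>?C. ?o S') \<le> (\<Sum>S'\<in>?C. 1)"
      using overlap_frac_bounds(2)[OF S] by (rule sum_mono)
    then show ?thesis using C by (simp add: mean_overlap_def)
  qed
  consider "\<not> typical D (negatives N n X S)" | "typical D (negatives N n X S)" "real (card ?C) \<le> z"
    | "typical D (negatives N n X S)" "z < real (card ?C)" by linarith
  then show ?thesis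
  proof cases
    case 3
    have "(\<Sum>S'\<in>?C. ?o S') \<le> (\<Sum>S'\<in>?C. \<epsilon> + (if \<epsilon> < ?o S' then 1 else 0))"
      using overlap_frac_bounds[OF S] \<epsilon>
      by (intro sum_mono) (smt (verit))
    also have "\<dots> = \<epsilon> * real (card ?C) + real (card {S' \<in> ?C. \<epsilon> < ?o S'})"
      by (simp add: sum.distrib sum.If_cases Int_def)
    also have "real (card {S' \<in> ?C. \<epsilon> < ?o S'}) = (\<Sum>S'\<in>?A. of_bool (agree D S S' X))"
    proof -
      have "?A \<inter> {S'. agree D S S' X} = {S' \<in> ?C. \<epsilon> < ?o S'}"
        using 3(1) by (auto simp: agree_def consistent_def)
      then show ?thesis by (simp add: of_bool_def sum.If_cases)
    qed
    finally have "mean_overlap N k n X S \<le> \<epsilon> + (\<Sum>S'\<in>?A. of_bool (agree D S S' X)) / real (card ?C)"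
      using C by (simp add: mean_overlap_def field_simps)
    also have "\<dots> \<le> \<epsilon> + (\<Sum>S'\<in>?A. of_bool (agree D S S' X)) / z"
      using 3(2) z nonneg by (intro add_left_mono divide_left_mono) auto
    finally show ?thesis by simp
  qed (use le1 nonneg z \<epsilon> in \<open>auto simp: add_nonneg_nonneg intro: order_trans\<close>)
qed

text \<open>For each design, a typical outcome with a class of size at most \<open>z\<close>
  accounts for at most \<open>z\<close> supports, and \<open>card_typical_le\<close> bounds the
  number of such outcomes. Dividing by the \<open>exp L\<close> supports gives the bound.\<close>

lemma prob_few_consistent_le:
  assumes z: "0 < z"
  shows "(\<Sum>S\<in>supports N k. \<Sum>X\<in>Designs n N. 1 / real (N choose k) * w X *
      of_bool (typical D (negatives N n X S) \<and> real (card (consistent N k n X (negatives N n X S))) \<le> z))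
    \<le> z * exp (H + slack D - L)"
proof -
  let ?M = "real (N choose k)"
  have M: "0 < ?M" using k_le by simp
  let ?P = "\<lambda>X B. typical D B \<and> real (card (consistent N k n X B)) \<le> z"
  have bound: "(\<Sum>S\<in>supports N k. of_bool (?P X (negatives N n X S)) :: real) \<le> z * exp (H + slack D)" for X
  proof -
    have "(\<Sum>S\<in>supports N k. of_bool (?P X (negatives N n X S)) :: real)
       = (\<Sum>B\<in>Pow {..<n}. \<Sum>S\<in>consistent N k n X B. of_bool (?P X (negatives N n X S)))"
      by (rule sum_supports_by_class[symmetric])
    also have "\<dots> = (\<Sum>B\<in>Pow {..<n}. real (card (consistent N k n X B)) * of_bool (?P X B))"
    proof (rule sum.cong[OF refl])
      fix B
      have "(\<Sum>S\<in>consistent N k n X B. of_bool (?P X (negatives N n X S)) :: real)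
          = (\<Sum>S\<in>consistent N k n X B. of_bool (?P X B))"
        by (rule sum.cong) (auto simp: consistent_def)
      then show "(\<Sum>S\<in>consistent N k n X B. of_bool (?P X (negatives N n X S)) :: real)
          = real (card (consistent N k n X B)) * of_bool (?P X B)" by simp
    qed
    also have "\<dots> \<le> (\<Sum>B\<in>Pow {..<n}. z * of_bool (typical D B))"
      using z by (intro sum_mono) auto
    also have "\<dots> = z * real (card {B. typical D B})"
    proof -
      have "Pow {..<n} \<inter> {B. typical D B} = {B. typical D B}" by (auto simp: typical_def)
      then show ?thesis by (simp add: of_bool_def sum.If_cases flip: sum_distrib_left)
    qed
    also have "\<dots> \<le> z * exp (H + slack D)"
      using card_typical_le z by (intro mult_left_mono) auto
    finally show ?thesis .
  qed
  have "(\<Sum>S\<in>supports N k. \<Sum>X\<in>Designs n N. 1 / ?M * w X * of_bool (?P X (negatives N n X S)))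
      = (\<Sum>X\<in>Designs n N. w X * ((\<Sum>S\<in>supports N k. of_bool (?P X (negatives N n X S))) / ?M))"
    by (subst sum.swap) (simp only: sum_distrib_left sum_divide_distrib times_divide_eq_right
        times_divide_eq_left mult_1_left)
  also have "\<dots> \<le> (\<Sum>X\<in>Designs n N. w X * (z * exp (H + slack D) / ?M))"
    using bound w_nonneg M by (intro sum_mono mult_left_mono divide_right_mono) auto
  also have "\<dots> = z * exp (H + slack D) / ?M"
    by (simp only: sum_distrib_right[symmetric] sum_design_prob mult_1_left)
  also have "\<dots> = z * exp (H + slack D - L)"
    using M by (simp add: exp_diff)
  finally show ?thesis .
qed

lemma average_le:
  assumes "\<And>S. S \<in> supports N k \<Longrightarrow> (\<Sum>X\<in>Designs n N. w X * f S X) \<le> c"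
  shows "(\<Sum>S\<in>supports N k. \<Sum>X\<in>Designs n N. 1 / real (N choose k) * w X * f S X) \<le> c"
proof -
  have M: "0 < real (N choose k)" using k_le by simp
  have "(\<Sum>S\<in>supports N k. \<Sum>X\<in>Designs n N. 1 / real (N choose k) * w X * f S X)
     = (\<Sum>S\<in>supports N k. (\<Sum>X\<in>Designs n N. w X * f S X) / real (N choose k))"
    by (simp add: sum_divide_distrib)
  also have "\<dots> \<le> (\<Sum>S\<in>supports N k. c / real (N choose k))"
    using assms M by (intro sum_mono divide_right_mono) auto
  also have "\<dots> = c" using M by (simp add: card_supports)
  finally show ?thesis .
qed

lemma average_one:
  "(\<Sum>S\<in>supports N k. \<Sum>X\<in>Designs n N. 1 / real (N choose k) * w X * c) = c"
proof -
  have "0 < real (N choose k)" using k_le by simp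
  then show ?thesis
    by (simp add: card_supports sum_design_prob flip: sum_distrib_right sum_divide_distrib)
qed

lemma MMSE_nonneg: "0 \<le> MMSE N k \<nu> n"
  unfolding MMSE_def using w_nonneg by (intro sum_nonneg mult_nonneg_nonneg) auto

lemma MMSE_le_one: "MMSE N k \<nu> n \<le> 1"
  unfolding MMSE_eq_overlap[OF k_pos k_le] using w_nonneg mean_overlap_nonneg
  by (simp, intro sum_nonneg divide_nonneg_nonneg mult_nonneg_nonneg) auto

text \<open>Above the threshold the factor \<open>L + slack D - H\<close> is not positive, so among
  overlaps below \<open>1 - \<epsilon>\<close> the exponent is at most its value at
  \<open>1 - \<epsilon>\<close>.\<close>

lemma MMSE_upper:
  assumes \<epsilon>: "0 < \<epsilon>" and D: "0 < D" and a: "L + slack D - H \<le> 0"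
  shows "MMSE N k \<nu> n \<le> \<epsilon> + real n / D^2 + (real k + 1) * exp (2 * real k + \<epsilon> * (L + slack D - H))"
proof -
  have "MMSE N k \<nu> n = (\<Sum>S\<in>supports N k. \<Sum>X\<in>Designs n N.
      1 / real (N choose k) * w X * (1 - mean_overlap N k n X S))"
    unfolding MMSE_eq_overlap[OF k_pos k_le] right_diff_distrib sum_subtractf average_one by simp
  also have "\<dots> \<le> \<epsilon> + real n / D^2 + (real k + 1) * exp (2 * real k + \<epsilon> * (L + slack D - H))"
  proof (rule average_le)
    fix S assume S: "S \<in> supports N k"
    let ?A = "{S' \<in> supports N k. real (card (S \<inter> S')) / real k < 1 - \<epsilon>}"
    have "(\<Sum>X\<in>Designs n N. w X * (1 - mean_overlap N k n X S))
       \<le> (\<Sum>X\<in>Designs n N. w X * (\<epsilon> + of_bool (\<not> typical D (negatives N n X S))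
           + (\<Sum>S'\<in>?A. of_bool (agree D S S' X))))"
      using mean_overlap_ge[OF S \<epsilon>] w_nonneg by (intro sum_mono mult_left_mono) auto
    also have "\<dots> = \<epsilon> + (\<Sum>X\<in>Designs n N. w X * of_bool (\<not> typical D (negatives N n X S)))
         + (\<Sum>X\<in>Designs n N. w X * (\<Sum>S'\<in>?A. of_bool (agree D S S' X)))"
      by (simp only: distrib_left sum.distrib sum_distrib_right[symmetric] sum_design_prob mult_1_left)
    also have "\<dots> \<le> \<epsilon> + real n / D^2 + (real k + 1) * exp (2 * real k + \<epsilon> * (L + slack D - H))"
    proof (intro add_mono prob_atypical_le[OF S D] order_refl expected_agreeing_le[OF S])
      fix l assume "real l / real k < 1 - \<epsilon>"
      then show "(1 - real l / real k) * (L + slack D - H) \<le> \<epsilon> * (L + slack D - H)"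
        using a by (intro mult_right_mono_neg) auto
    qed
    finally show "(\<Sum>X\<in>Designs n N. w X * (1 - mean_overlap N k n X S))
      \<le> \<epsilon> + real n / D^2 + (real k + 1) * exp (2 * real k + \<epsilon> * (L + slack D - H))" .
  qed
  finally show ?thesis .
qed

lemma MMSE_lower:
  assumes \<epsilon>: "0 < \<epsilon>" and D: "0 < D" and a: "0 \<le> L + slack D - H"
  shows "1 - MMSE N k \<nu> n \<le> \<epsilon> + real n / D^2 + exp (- slack D)
     + (real k + 1) * exp (2 * real k + 3 * slack D - \<epsilon> * (L + slack D - H))"
proof -
  \<comment> \<open>A threshold slightly below the class size \<open>exp (L - H)\<close>: smaller
    classes occur with probability at most \<open>exp (- slack D)\<close>, while dividing by
    \<open>z\<close> leaves the exponent
    \<open>3 * slack D - \<epsilon> * (L + slack D - H)\<close>.\<close>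
  define z where "z = exp (L - H - 2 * slack D)"
  have z: "0 < z" by (simp add: z_def)
  let ?few = "\<lambda>X S. of_bool (typical D (negatives N n X S)
      \<and> real (card (consistent N k n X (negatives N n X S))) \<le> z) :: real"
  let ?A = "\<lambda>S. {S' \<in> supports N k. \<epsilon> < real (card (S \<inter> S')) / real k}"
  let ?R = "\<lambda>S X. \<epsilon> + of_bool (\<not> typical D (negatives N n X S)) + (\<Sum>S'\<in>?A S. of_bool (agree D S S' X)) / z"
  have "1 - MMSE N k \<nu> n = (\<Sum>S\<in>supports N k. \<Sum>X\<in>Designs n N.
      1 / real (N choose k) * w X * mean_overlap N k n X S)"
    unfolding MMSE_eq_overlap[OF k_pos k_le] by simp
  also have "\<dots> \<le> (\<Sum>S\<in>supports N k. \<Sum>X\<in>Designs n N. 1 / real (N choose k) * w X * (?R S X + ?few X S))"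
    using mean_overlap_le[OF _ \<epsilon> z] w_nonneg
    by (intro sum_mono mult_left_mono) (auto simp: algebra_simps)
  also have "\<dots> = (\<Sum>S\<in>supports N k. \<Sum>X\<in>Designs n N. 1 / real (N choose k) * w X * ?R S X)
      + (\<Sum>S\<in>supports N k. \<Sum>X\<in>Designs n N. 1 / real (N choose k) * w X * ?few X S)"
    by (simp only: distrib_left sum.distrib)
  also have "\<dots> \<le> (\<epsilon> + real n / D^2
      + (real k + 1) * exp (2 * real k + 3 * slack D - \<epsilon> * (L + slack D - H))) + exp (- slack D)"
  proof (rule add_mono)
    have "(\<Sum>S\<in>supports N k. \<Sum>X\<in>Designs n N. 1 / real (N choose k) * w X * ?few X S)
      \<le> z * exp (H + slack D - L)"
      by (rule prob_few_consistent_le[OF z])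
    also have "\<dots> = exp (- slack D)" by (simp add: z_def flip: exp_add)
    finally show "(\<Sum>S\<in>supports N k. \<Sum>X\<in>Designs n N. 1 / real (N choose k) * w X * ?few X S)
      \<le> exp (- slack D)" .
  next
    show "(\<Sum>S\<in>supports N k. \<Sum>X\<in>Designs n N. 1 / real (N choose k) * w X * ?R S X)
      \<le> \<epsilon> + real n / D^2 + (real k + 1) * exp (2 * real k + 3 * slack D - \<epsilon> * (L + slack D - H))"
    proof (rule average_le)
      fix S assume S: "S \<in> supports N k"
      have "(\<Sum>X\<in>Designs n N. w X * ?R S X)
          = \<epsilon> + (\<Sum>X\<in>Designs n N. w X * of_bool (\<not> typical D (negatives N n X S)))
           + (\<Sum>X\<in>Designs n N. w X * (\<Sum>S'\<in>?A S. of_bool (agree D S S' X))) / z"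
        by (simp only: distrib_left sum.distrib sum_distrib_right[symmetric] sum_design_prob
            times_divide_eq_right sum_divide_distrib[symmetric] mult_1_left)
      also have "\<dots> \<le> \<epsilon> + real n / D^2 + (real k + 1) * exp (2 * real k + (1 - \<epsilon>) * (L + slack D - H)) / z"
      proof (intro add_mono prob_atypical_le[OF S D] order_refl divide_right_mono expected_agreeing_le[OF S])
        fix l assume "\<epsilon> < real l / real k"
        then show "(1 - real l / real k) * (L + slack D - H) \<le> (1 - \<epsilon>) * (L + slack D - H)"
          using a by (intro mult_right_mono) auto
      qed (use z in auto)
      also have "(real k + 1) * exp (2 * real k + (1 - \<epsilon>) * (L + slack D - H)) / z
          = (real k + 1) * exp (2 * real k + 3 * slack D - \<epsilon> * (L + slack D - H))"
        by (simp only: z_def times_divide_eq_right[symmetric] exp_diff[symmetric])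
          (simp add: algebra_simps)
      finally show "(\<Sum>X\<in>Designs n N. w X * ?R S X)
         \<le> \<epsilon> + real n / D^2 + (real k + 1) * exp (2 * real k + 3 * slack D - \<epsilon> * (L + slack D - H))" .
    qed
  qed
  finally show ?thesis by simp
qed

end

lemma bin_entropy_pos:
  assumes "0 < q" "q < 1"
  shows "0 < bin_entropy q"
proof -
  have "q * ln q < 0" "(1 - q) * ln (1 - q) < 0"
    using assms by (auto intro!: mult_pos_neg)
  then show ?thesis unfolding bin_entropy_def by linarith
qed

subsection \<open>The limit\<close>

text \<open>Since \<open>k + 1 \<le> exp k\<close>, the exponent is at most
  \<open>3 * k - \<gamma> * L\<close>. Eventually \<open>k < \<gamma> / 6 * L\<close>, which leaves
  at most \<open>- (\<gamma> / 2) * L\<close>.\<close>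

lemma residual_tendsto_0:
  fixes k :: "nat \<Rightarrow> nat" and L :: "nat \<Rightarrow> real"
  assumes L: "filterlim L at_top sequentially"
    and kL: "(\<lambda>N. real (k N) / L N) \<longlonglongrightarrow> 0" and \<gamma>: "0 < \<gamma>"
  shows "(\<lambda>N. (real (k N) + 1) * exp (2 * real (k N) - \<gamma> * L N)) \<longlonglongrightarrow> 0"
proof (rule tendsto_sandwich)
  show "\<forall>\<^sub>F N in sequentially. 0 \<le> (real (k N) + 1) * exp (2 * real (k N) - \<gamma> * L N)"
    by simp
  have "\<forall>\<^sub>F N in sequentially. real (k N) / L N < \<gamma> / 6"
    using kL \<gamma> by (intro order_tendstoD) auto
  moreover have "\<forall>\<^sub>F N in sequentially. 0 < L N"
    using L by (simp add: filterlim_at_top_dense)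
  ultimately show "\<forall>\<^sub>F N in sequentially.
      (real (k N) + 1) * exp (2 * real (k N) - \<gamma> * L N) \<le> exp (- (\<gamma> / 2) * L N)"
  proof eventually_elim
    case (elim N)
    then have *: "real (k N) < \<gamma> / 6 * L N" by (simp add: pos_divide_less_eq)
    have "(real (k N) + 1) * exp (2 * real (k N) - \<gamma> * L N)
        \<le> exp (real (k N)) * exp (2 * real (k N) - \<gamma> * L N)"
      using exp_ge_add_one_self[of "real (k N)"] by (intro mult_right_mono) (auto simp: add.commute)
    also have "\<dots> \<le> exp (- (\<gamma> / 2) * L N)" using * by (simp flip: exp_add)
    finally show ?case .
  qed
  have "filterlim (\<lambda>N. - (\<gamma> / 2) * L N) at_bot sequentially"
    using L \<gamma> by (intro filterlim_tendsto_neg_mult_at_bot[OF tendsto_const]) auto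
  then show "(\<lambda>N. exp (- (\<gamma> / 2) * L N)) \<longlonglongrightarrow> 0"
    by (rule filterlim_compose[OF exp_at_bot])
qed simp

context
  fixes k n :: "nat \<Rightarrow> nat" and \<nu> L :: "nat \<Rightarrow> real" and q :: real
  assumes L_def: "\<And>N. L N = ln (real (N choose k N))"
    and L_inf: "filterlim L at_top sequentially"
    and kL: "(\<lambda>N. real (k N) / L N) \<longlonglongrightarrow> 0"
    and model: "\<forall>\<^sub>F N in sequentially. bernoulli_group_testing N (k N) (\<nu> N) q"
    and q_pos: "0 < q" and q_le: "q \<le> 1 / 2"
begin

lemma L_eventually_pos: "\<forall>\<^sub>F N in sequentially. 0 < L N"
  using L_inf by (simp add: filterlim_at_top_dense)

lemma inverse_L_tendsto: "(\<lambda>N. c / L N) \<longlonglongrightarrow> 0"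
  using L_inf by (intro tendsto_divide_0[OF tendsto_const] filterlim_at_top_imp_at_infinity)

text \<open>The Chebyshev term for the radius \<open>D = d * L\<close>: it is of order
  \<open>1 / L\<close> when \<open>n\<close> is of order at most \<open>L\<close>, while
  \<open>slack D\<close> stays a small multiple of \<open>L\<close>.\<close>

lemma deviation_le:
  assumes "0 < L N" "0 < d" "real (n N) * bin_entropy q \<le> b * L N"
  shows "real (n N) / (d * L N)^2 \<le> (b / (bin_entropy q * d^2)) / L N"
proof -
  have h: "0 < bin_entropy q" using q_pos q_le by (intro bin_entropy_pos) auto
  then have "real (n N) \<le> b * L N / bin_entropy q" using assms(3) by (simp add: pos_le_divide_eq)
  then have "real (n N) / (d * L N)^2 \<le> (b * L N / bin_entropy q) / (d * L N)^2"
    by (rule divide_right_mono) simp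
  also have "\<dots> = (b / (bin_entropy q * d^2)) / L N"
    using assms h by (simp add: power2_eq_square divide_simps)
  finally show ?thesis .
qed

lemma MMSE_tendsto_0:
  assumes \<beta>: "1 < \<beta>"
    and n_ge: "\<forall>\<^sub>F N in sequentially. \<beta> * L N \<le> real (n N) * bin_entropy q"
    and n_le: "\<forall>\<^sub>F N in sequentially. real (n N) * bin_entropy q \<le> b * L N"
  shows "(\<lambda>N. MMSE N (k N) (\<nu> N) (n N)) \<longlonglongrightarrow> 0"
proof (rule order_tendstoI)
  fix y :: real assume "y < 0"
  then show "\<forall>\<^sub>F N in sequentially. y < MMSE N (k N) (\<nu> N) (n N)"
    using bernoulli_group_testing.MMSE_nonneg
    by (intro eventually_mono[OF model]) (rule less_le_trans)
next
  fix y :: real assume y: "0 < y"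
  define \<epsilon> where "\<epsilon> = y / 2"
  define c where "c = - ln q"
  \<comment> \<open>Half of the gap: with \<open>slack (d * L) = s * L\<close>, the quantity
    \<open>L + slack - H\<close> is at most \<open>(1 + s - \<beta>) * L = - s * L\<close>, and the
    factor \<open>\<epsilon>\<close> turns this into the rate \<open>\<gamma>\<close>.\<close>
  define s where "s = (\<beta> - 1) / 2"
  define d where "d = s / c"
  define \<gamma> where "\<gamma> = \<epsilon> * s"
  have pos: "0 < \<epsilon>" "0 < c" "0 < s" "0 < d" "0 < \<gamma>" "c * d = s"
    using y \<beta> q_pos q_le by (auto simp: \<epsilon>_def c_def s_def d_def \<gamma>_def divide_less_0_iff)
  let ?u = "\<lambda>N. \<epsilon> + (b / (bin_entropy q * d^2)) / L N + (real (k N) + 1) * exp (2 * real (k N) - \<gamma> * L N)"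
  have u: "?u \<longlonglongrightarrow> \<epsilon> + 0 + 0"
    by (intro tendsto_add tendsto_const inverse_L_tendsto residual_tendsto_0[OF L_inf kL] pos)
  have "\<forall>\<^sub>F N in sequentially. ?u N < y"
    using pos(1) by (intro order_tendstoD(2)[OF u]) (simp add: \<epsilon>_def)
  with model n_ge n_le L_eventually_pos show "\<forall>\<^sub>F N in sequentially. MMSE N (k N) (\<nu> N) (n N) < y"
  proof eventually_elim
    case (elim N)
    interpret bernoulli_group_testing N "k N" "n N" "\<nu> N" q by (rule elim(1))
    have D: "0 < d * L N" using pos elim by simp
    have sl: "slack (d * L N) = s * L N"
      using pos by (simp add: slack_def c_def[symmetric] mult.assoc[symmetric])
    have a: "L N + slack (d * L N) - real (n N) * bin_entropy q \<le> - s * L N"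
      using elim(2) unfolding sl by (simp add: s_def field_simps)
    moreover have "0 < s * L N" using pos elim by simp
    ultimately have a0: "L N + slack (d * L N) - real (n N) * bin_entropy q \<le> 0" by linarith
    have "MMSE N (k N) (\<nu> N) (n N) \<le> \<epsilon> + real (n N) / (d * L N)^2
      + (real (k N) + 1) * exp (2 * real (k N) + \<epsilon> * (L N + slack (d * L N) - real (n N) * bin_entropy q))"
      using MMSE_upper[OF pos(1) D] a0 unfolding L_def by blast
    also have "\<dots> \<le> ?u N"
    proof (intro add_mono order_refl mult_left_mono deviation_le)
      have "\<epsilon> * (L N + slack (d * L N) - real (n N) * bin_entropy q) \<le> \<epsilon> * (- s * L N)"
        using a pos by (intro mult_left_mono) auto
      then show "exp (2 * real (k N) + \<epsilon> * (L N + slack (d * L N) - real (n N) * bin_entropy q))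
         \<le> exp (2 * real (k N) - \<gamma> * L N)"
        by (simp add: \<gamma>_def mult.assoc)
    qed (use elim pos in auto)
    finally show ?case using elim(5) by simp
  qed
qed

lemma MMSE_tendsto_1:
  assumes \<eta>: "\<eta> < 1"
    and n_le: "\<forall>\<^sub>F N in sequentially. real (n N) * bin_entropy q \<le> \<eta> * L N"
  shows "(\<lambda>N. MMSE N (k N) (\<nu> N) (n N)) \<longlonglongrightarrow> 1"
proof (rule order_tendstoI)
  fix y :: real assume "1 < y"
  then show "\<forall>\<^sub>F N in sequentially. MMSE N (k N) (\<nu> N) (n N) < y"
    using bernoulli_group_testing.MMSE_le_one
    by (intro eventually_mono[OF model]) (rule le_less_trans)
next
  fix y :: real assume y: "y < 1"
  define \<epsilon> where "\<epsilon> = (1 - y) / 2"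
  define c where "c = - ln q"
  \<comment> \<open>Below the threshold \<open>L + slack - H\<close> is at least
    \<open>(1 - \<eta>) * L\<close>, so \<open>\<epsilon>\<close> times it is at least
    \<open>6 * s * L\<close>. This beats the loss \<open>3 * slack = 3 * s * L\<close> and leaves
    the rate \<open>\<gamma> = 3 * s\<close>.\<close>
  define s where "s = \<epsilon> * (1 - \<eta>) / 6"
  define d where "d = s / c"
  define \<gamma> where "\<gamma> = 3 * s"
  have pos: "0 < \<epsilon>" "0 < c" "0 < s" "0 < d" "0 < \<gamma>" "c * d = s"
    using y \<eta> q_pos q_le by (auto simp: \<epsilon>_def c_def s_def d_def \<gamma>_def divide_less_0_iff)
  let ?u = "\<lambda>N. \<epsilon> + (\<eta> / (bin_entropy q * d^2)) / L N + exp (- s * L N)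
     + (real (k N) + 1) * exp (2 * real (k N) - \<gamma> * L N)"
  have "filterlim (\<lambda>N. - s * L N) at_bot sequentially"
    using L_inf pos by (intro filterlim_tendsto_neg_mult_at_bot[OF tendsto_const]) auto
  then have "(\<lambda>N. exp (- s * L N)) \<longlonglongrightarrow> 0"
    by (rule filterlim_compose[OF exp_at_bot])
  then have u: "?u \<longlonglongrightarrow> \<epsilon> + 0 + 0 + 0"
    by (intro tendsto_add tendsto_const inverse_L_tendsto residual_tendsto_0[OF L_inf kL] pos)
  have "\<forall>\<^sub>F N in sequentially. ?u N < 1 - y"
    using pos(1) by (intro order_tendstoD(2)[OF u]) (simp add: \<epsilon>_def)
  with model n_le L_eventually_pos show "\<forall>\<^sub>F N in sequentially. y < MMSE N (k N) (\<nu> N) (n N)"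
  proof eventually_elim
    case (elim N)
    interpret bernoulli_group_testing N "k N" "n N" "\<nu> N" q by (rule elim(1))
    have D: "0 < d * L N" using pos elim by simp
    have sl: "slack (d * L N) = s * L N"
      using pos by (simp add: slack_def c_def[symmetric] mult.assoc[symmetric])
    have "0 < s * L N" "0 < (1 - \<eta>) * L N" using pos elim \<eta> by auto
    then have a: "(1 - \<eta>) * L N \<le> L N + slack (d * L N) - real (n N) * bin_entropy q"
      using elim(2) unfolding sl by (simp add: left_diff_distrib)
    with \<open>0 < (1 - \<eta>) * L N\<close> have a0: "0 \<le> L N + slack (d * L N) - real (n N) * bin_entropy q" by linarith
    have "1 - MMSE N (k N) (\<nu> N) (n N) \<le> \<epsilon> + real (n N) / (d * L N)^2 + exp (- slack (d * L N))
      + (real (k N) + 1) * exp (2 * real (k N) + 3 * slack (d * L N)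
           - \<epsilon> * (L N + slack (d * L N) - real (n N) * bin_entropy q))"
      using MMSE_lower[OF pos(1) D] a0 unfolding L_def by blast
    also have "\<dots> \<le> ?u N"
    proof (intro add_mono order_refl mult_left_mono deviation_le)
      have "\<epsilon> * ((1 - \<eta>) * L N) \<le> \<epsilon> * (L N + slack (d * L N) - real (n N) * bin_entropy q)"
        using a pos by (intro mult_left_mono) auto
      moreover have "\<epsilon> * ((1 - \<eta>) * L N) = 6 * (s * L N)" by (simp add: s_def)
      ultimately show "exp (2 * real (k N) + 3 * slack (d * L N)
           - \<epsilon> * (L N + slack (d * L N) - real (n N) * bin_entropy q))
         \<le> exp (2 * real (k N) - \<gamma> * L N)"
        unfolding sl \<gamma>_def by simp
    qed (use elim pos sl in auto)
    finally show ?case using elim(4) by simp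
  qed
qed

end

section \<open>Rounding, both regimes, and the asymptotics of the critical sample size\<close>

lemma nat_floor_bounds:
  fixes x :: real
  assumes "0 \<le> x"
  shows "x - 1 < real (nat \<lfloor>x\<rfloor>)" "real (nat \<lfloor>x\<rfloor>) \<le> x"
  using assms by linarith+

theorem theorem2:
  fixes q :: real and k :: "nat \<Rightarrow> nat" and \<nu> :: "nat \<Rightarrow> real"
  assumes q_pos: "0 < q" and q_le: "q \<le> 1 / 2"
    and k_inf: "filterlim k at_top sequentially"
    and k_small: "(\<lambda>N. real (k N) / real N) \<longlonglongrightarrow> 0"
    and nu_pos: "\<And>N. 0 < \<nu> N"
    and nu_le: "\<And>N. \<nu> N \<le> real (k N)"
    and nu_eq: "\<And>N. (1 - \<nu> N / real (k N)) ^ k N = q"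
  shows "(\<forall>\<beta>::real. \<beta> < 1 \<longrightarrow>
            (\<lambda>N. MMSE N (k N) (\<nu> N) (nat \<lfloor>\<beta> * real (nstar N (k N) q)\<rfloor>)) \<longlonglongrightarrow> 1)
       \<and> (\<forall>\<beta>::real. \<beta> > 1 \<longrightarrow>
            (\<lambda>N. MMSE N (k N) (\<nu> N) (nat \<lfloor>\<beta> * real (nstar N (k N) q)\<rfloor>)) \<longlonglongrightarrow> 0)
       \<and> (\<lambda>N. real (nstar N (k N) q) /
              (real (k N) * ln (real N / real (k N)) / bin_entropy q)) \<longlonglongrightarrow> 1"
proof -
  define L where "L N = ln (real (N choose k N))" for N
  define g where "g N = ln (real N / real (k N))" for N
  let ?h = "bin_entropy q"
  have h: "0 < ?h" using q_pos q_le by (intro bin_entropy_pos) auto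
  have k_pos: "0 < k N" for N
    using nu_pos[of N] nu_le[of N] by (cases "k N") auto
  have k_less: "\<forall>\<^sub>F N in sequentially. k N < N"
  proof -
    have "\<forall>\<^sub>F N in sequentially. real (k N) / real N < 1"
      using k_small by (rule order_tendstoD) simp
    with eventually_gt_at_top[of 0] show ?thesis
      by eventually_elim (simp add: divide_less_eq_1_pos)
  qed
  then have model: "\<forall>\<^sub>F N in sequentially. bernoulli_group_testing N (k N) (\<nu> N) q"
    by eventually_elim (unfold_locales, use k_pos nu_pos nu_le nu_eq q_pos q_le in \<open>auto simp: less_imp_le\<close>)
  have g_inf: "filterlim g at_top sequentially"
  proof -
    have "\<forall>\<^sub>F N in sequentially. 0 < real (k N) / real N"
      using k_less by eventually_elim (use k_pos in auto)
    then have "filterlim (\<lambda>N. inverse (real (k N) / real N)) at_top sequentially"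
      by (intro filterlim_inverse_at_top k_small)
    then have "filterlim (\<lambda>N. ln (inverse (real (k N) / real N))) at_top sequentially"
      by (rule filterlim_compose[OF ln_at_top])
    then show ?thesis by (simp add: g_def[abs_def])
  qed
  have g_ge: "\<forall>\<^sub>F N in sequentially. 1 \<le> g N"
    using g_inf by (simp add: filterlim_at_top)
  have Lg: "\<forall>\<^sub>F N in sequentially. real (k N) * g N \<le> L N \<and> L N \<le> real (k N) * g N + real (k N)"
    using k_less by eventually_elim (use ln_binomial_bounds[OF k_pos] in \<open>auto simp: L_def g_def\<close>)
  have kr: "filterlim (\<lambda>N. real (k N)) at_top sequentially"
    by (rule filterlim_compose[OF filterlim_real_sequentially k_inf])
  have L_inf: "filterlim L at_top sequentially"
  proof (rule filterlim_at_top_mono[OF kr])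
    show "\<forall>\<^sub>F N in sequentially. real (k N) \<le> L N"
      using Lg g_ge
    proof eventually_elim
      case (elim N)
      then have "real (k N) * 1 \<le> real (k N) * g N" by (intro mult_left_mono) auto
      then show ?case using elim by linarith
    qed
  qed
  have inv_g: "(\<lambda>N. 1 / g N) \<longlonglongrightarrow> 0"
    using g_inf by (intro tendsto_divide_0[OF tendsto_const] filterlim_at_top_imp_at_infinity)
  \<comment> \<open>From \<open>k * g \<le> L\<close> the quotient is at most \<open>1 / g\<close>,
    and \<open>g\<close> tends to infinity because \<open>k / N\<close> tends to 0.\<close>
  have kL: "(\<lambda>N. real (k N) / L N) \<longlonglongrightarrow> 0"
  proof (rule tendsto_sandwich[OF _ _ tendsto_const inv_g])
    have L_pos: "\<forall>\<^sub>F N in sequentially. 0 < L N" using L_inf by (simp add: filterlim_at_top_dense)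
    then show "\<forall>\<^sub>F N in sequentially. 0 \<le> real (k N) / L N" by eventually_elim simp
    from L_pos Lg g_ge show "\<forall>\<^sub>F N in sequentially. real (k N) / L N \<le> 1 / g N"
      by eventually_elim (simp add: divide_simps)
  qed
  have ratio: "(\<lambda>N. L N / (real (k N) * g N)) \<longlonglongrightarrow> 1"
  proof (rule tendsto_sandwich[OF _ _ tendsto_const])
    show "\<forall>\<^sub>F N in sequentially. 1 \<le> L N / (real (k N) * g N)"
      using Lg g_ge by eventually_elim (use k_pos in \<open>auto simp: divide_simps\<close>)
    show "\<forall>\<^sub>F N in sequentially. L N / (real (k N) * g N) \<le> 1 + 1 / g N"
      using Lg g_ge
    proof eventually_elim
      case (elim N)
      have "L N / (real (k N) * g N) \<le> (real (k N) * g N + real (k N)) / (real (k N) * g N)"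
        using elim by (intro divide_right_mono) auto
      also have "\<dots> = 1 + 1 / g N" using elim k_pos[of N] by (simp add: add_divide_distrib)
      finally show ?case .
    qed
    show "(\<lambda>N. 1 + 1 / g N) \<longlonglongrightarrow> 1" using tendsto_add[OF tendsto_const inv_g, of 1] by simp
  qed
  have L_pos: "\<forall>\<^sub>F N in sequentially. 0 < L N"
    using L_inf by (simp add: filterlim_at_top_dense)
  have nstar: "L N / ?h - 1 < real (nstar N (k N) q)" "real (nstar N (k N) q) \<le> L N / ?h" if "0 < L N" for N
    using nat_floor_bounds[of "L N / ?h"] that h by (simp_all add: nstar_def L_def)
  have inv_L: "(\<lambda>N. c / L N) \<longlonglongrightarrow> 0" for c
    using L_inf by (intro tendsto_divide_0[OF tendsto_const] filterlim_at_top_imp_at_infinity)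
  have "(\<lambda>N. MMSE N (k N) (\<nu> N) (nat \<lfloor>\<beta> * real (nstar N (k N) q)\<rfloor>)) \<longlonglongrightarrow> 1" if \<beta>: "\<beta> < 1" for \<beta>
  proof (rule MMSE_tendsto_1[OF L_def L_inf kL model q_pos q_le])
    \<comment> \<open>A negative \<open>\<beta>\<close> gives sample size 0 through
      \<open>nat\<close>; taking the maximum with 0 covers this case as well.\<close>
    show "max \<beta> 0 < 1" using \<beta> by simp
    show "\<forall>\<^sub>F N in sequentially. real (nat \<lfloor>\<beta> * real (nstar N (k N) q)\<rfloor>) * ?h \<le> max \<beta> 0 * L N"
      using L_pos
    proof eventually_elim
      case (elim N)
      have "real (nat \<lfloor>\<beta> * real (nstar N (k N) q)\<rfloor>) \<le> real (nat \<lfloor>max \<beta> 0 * real (nstar N (k N) q)\<rfloor>)"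
        by (intro of_nat_mono nat_mono floor_mono mult_right_mono) auto
      also have "\<dots> \<le> max \<beta> 0 * real (nstar N (k N) q)" by (intro nat_floor_bounds) simp
      also have "\<dots> \<le> max \<beta> 0 * (L N / ?h)" using nstar(2)[OF elim] by (intro mult_left_mono) auto
      finally show ?case using h by (simp add: pos_le_divide_eq)
    qed
  qed
  moreover have "(\<lambda>N. MMSE N (k N) (\<nu> N) (nat \<lfloor>\<beta> * real (nstar N (k N) q)\<rfloor>)) \<longlonglongrightarrow> 0" if \<beta>: "1 < \<beta>" for \<beta>
  proof (rule MMSE_tendsto_0[OF L_def L_inf kL model q_pos q_le])
    \<comment> \<open>The midpoint of 1 and \<open>\<beta>\<close> leaves room for the two
      roundings. The inner floor costs less than \<open>\<beta>\<close> tests and the outer one less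
      than 1, in total \<open>(\<beta> + 1) * ?h\<close> after scaling, which is eventually below
      \<open>(\<beta> - 1) / 2 * L\<close>.\<close>
    show "1 < (1 + \<beta>) / 2" using \<beta> by simp
    show "\<forall>\<^sub>F N in sequentially. real (nat \<lfloor>\<beta> * real (nstar N (k N) q)\<rfloor>) * ?h \<le> \<beta> * L N"
      using L_pos
    proof eventually_elim
      case (elim N)
      have "real (nat \<lfloor>\<beta> * real (nstar N (k N) q)\<rfloor>) \<le> \<beta> * real (nstar N (k N) q)"
        using \<beta> by (intro nat_floor_bounds) simp
      also have "\<dots> \<le> \<beta> * (L N / ?h)" using nstar(2)[OF elim] \<beta> by (intro mult_left_mono) auto
      finally show ?case using h by (simp add: pos_le_divide_eq)
    qed
    have "\<forall>\<^sub>F N in sequentially. (\<beta> + 1) * ?h / L N < (\<beta> - 1) / 2"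
      using \<beta> by (intro order_tendstoD(2)[OF inv_L]) simp
    with L_pos show "\<forall>\<^sub>F N in sequentially.
        (1 + \<beta>) / 2 * L N \<le> real (nat \<lfloor>\<beta> * real (nstar N (k N) q)\<rfloor>) * ?h"
    proof eventually_elim
      case (elim N)
      have "\<beta> * (L N / ?h - 1) - 1 \<le> \<beta> * real (nstar N (k N) q) - 1"
        using nstar(1)[OF elim(1)] \<beta> by simp
      also have "\<dots> \<le> real (nat \<lfloor>\<beta> * real (nstar N (k N) q)\<rfloor>)"
        using nat_floor_bounds(1)[of "\<beta> * real (nstar N (k N) q)"] \<beta> by simp
      finally have "(\<beta> * (L N / ?h - 1) - 1) * ?h \<le> real (nat \<lfloor>\<beta> * real (nstar N (k N) q)\<rfloor>) * ?h"
        using h by (intro mult_right_mono) auto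
      moreover have "(\<beta> * (L N / ?h - 1) - 1) * ?h = \<beta> * L N - (\<beta> + 1) * ?h"
        using h by (simp add: field_simps)
      moreover have "(\<beta> + 1) * ?h < (\<beta> - 1) / 2 * L N"
        using elim by (simp add: pos_divide_less_eq)
      ultimately show ?case by (simp add: field_simps)
    qed
  qed
  \<comment> \<open>The ratio splits into the effect of the floor, which vanishes as
    \<open>L\<close> grows, and the ratio of \<open>ln (N choose k)\<close> to
    \<open>k * ln (N / k)\<close>.\<close>
  moreover have "(\<lambda>N. real (nstar N (k N) q) / (real (k N) * g N / ?h)) \<longlonglongrightarrow> 1"
  proof -
    have floor_ratio: "(\<lambda>N. real (nstar N (k N) q) / (L N / ?h)) \<longlonglongrightarrow> 1"
    proof (rule tendsto_sandwich[OF _ _ _ tendsto_const])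
      show "\<forall>\<^sub>F N in sequentially. 1 - ?h / L N \<le> real (nstar N (k N) q) / (L N / ?h)"
        using L_pos
      proof eventually_elim
        case (elim N)
        have "1 - ?h / L N = (L N / ?h - 1) / (L N / ?h)" using elim h by (simp add: field_simps)
        also have "\<dots> \<le> real (nstar N (k N) q) / (L N / ?h)"
          using nstar(1)[OF elim] elim h by (intro divide_right_mono) auto
        finally show ?case .
      qed
      show "\<forall>\<^sub>F N in sequentially. real (nstar N (k N) q) / (L N / ?h) \<le> 1"
        using L_pos
      proof eventually_elim
        case (elim N)
        then show ?case using nstar(2)[OF elim] h by (subst divide_le_eq_1_pos) auto
      qed
      show "(\<lambda>N. 1 - ?h / L N) \<longlonglongrightarrow> 1" using tendsto_diff[OF tendsto_const inv_L, of 1 ?h] by simp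
    qed
    have "(\<lambda>N. real (nstar N (k N) q) / (L N / ?h) * (L N / (real (k N) * g N))) \<longlonglongrightarrow> 1"
      using tendsto_mult[OF floor_ratio ratio] by simp
    then show ?thesis
    proof (rule Lim_transform_eventually)
      show "\<forall>\<^sub>F N in sequentially. real (nstar N (k N) q) / (L N / ?h) * (L N / (real (k N) * g N))
         = real (nstar N (k N) q) / (real (k N) * g N / ?h)"
        using L_pos by eventually_elim (simp add: divide_simps)
    qed
  qed
  ultimately show ?thesis by (auto simp: g_def)
qed

end
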